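(* Let $\alpha>0$, let $f\in C([0,\infty))$ with $f(0)\ge 0$, and let $g\in L^1((0,T))$ for all $T>0$. Assume that for some $\tau\in(0,\infty]$ one has $\operatorname{ess\,sup}_{0<t<\tau} g(t)\le 0$ and $G(t)>0$ for all $t\in(0,\tau)$. If $$f(t)\ge k_0G(t)-K_0\,G(t)L(t)^2\bigl(1+J(t)^2\bigr)\quad\text{for all }t\in(0,\tau),\qquad K_0:=\frac{\alpha^{\frac1{\alpha+1}}}{2(\alpha+1)},$$ then the equation $$x(t)=f(t)+\int_0^t\frac{g(s)}{x^\alpha(s)}\,ds$$ has a maximal solution $\tilde x(t;0)$ on some interval $[0,\delta)\subset[0,\tau)$, $\delta>0$, and $$0\ge \tilde x(t;0)-f(t)\ge -\alpha^{-\frac{\alpha}{\alpha+1}}\Bigl(G(t)+\frac{\alpha}{\alpha+1}\,G(t)L(t)\bigl(1+J(t)+J(t)^2\bigr)\Bigr)\quad\text{for all }t\in(0,\delta).$$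
   Context: Notation: $G(t):=\bigl|(\alpha+1)\int_0^t g(s)\,ds\bigr|^{\frac1{\alpha+1}}$, $L(t):=1/|\ln G(t)|$, $J(t):=1/|\ln L(t)|$, and $k_0:=(\alpha+1)\alpha^{-\frac{\alpha}{\alpha+1}}$. (Since $G(t)\to0$ as $t\downarrow0$, $L$ and $J$ are well defined for small $t>0$; inequalities involving them are understood at the times $t$ where they are defined.) Notion of solution. Put $I(s,x)=g(s)/x^\alpha$ if $x>0$; and, for $x=0$, $I(s,0)=-\infty$, $0$, $+\infty$ according to whether $g(s)<0$, $g(s)=0$, $g(s)>0$. A function $x$ is a solution of the equation on $[0,\delta)$ if it is real, nonnegative and continuous on $[0,\delta)$, $s\mapsto I(s,x(s))$ belongs to $L^1_{\rm loc}((0,\delta))$, and for every $t\in(0,\delta)$ the limit $\int_0^t I(s,x(s))\,ds:=\lim_{\varepsilon\downarrow0}\int_\varepsilon^t I(s,x(s))\,ds$ exists and $x(t)=f(t)+\int_0^t I(s,x(s))\,ds$. Maximal solution. For $\mu>0$, let $x(\cdot;\mu)$ be the unique positive solution of $x(t)=\mu+f(t)+\int_0^t g(s)x^{-\alpha}(s)\,ds$, defined on its maximal interval $[0,T(\mu))$ (either $T(\mu)=\infty$ or $x(t;\mu)\to0$ as $t\uparrow T(\mu)$), and put $\tilde x(t;0):=\inf\{x(t;\mu):\mu>0,\ T(\mu)>t\}$. When $\tilde x(\cdot;0)$ is a solution it is the maximal one: every solution $x$ on an interval $[0,\delta')$ satisfies $x\le\tilde x(\cdot;0)$ there. *)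

theory Defs
  imports "HOL-Analysis.Analysis" "HOL-Probability.Essential_Supremum"
begin

definition G_fun :: "real \<Rightarrow> (real \<Rightarrow> real) \<Rightarrow> real \<Rightarrow> real" where
  "G_fun \<alpha> g t = \<bar>(\<alpha> + 1) * set_lebesgue_integral lebesgue {0..t} g\<bar> powr (1 / (\<alpha> + 1))"

definition L_fun :: "real \<Rightarrow> (real \<Rightarrow> real) \<Rightarrow> real \<Rightarrow> real" where
  "L_fun \<alpha> g t = 1 / \<bar>ln (G_fun \<alpha> g t)\<bar>"

definition J_fun :: "real \<Rightarrow> (real \<Rightarrow> real) \<Rightarrow> real \<Rightarrow> real" where
  "J_fun \<alpha> g t = 1 / \<bar>ln (L_fun \<alpha> g t)\<bar>"

text \<open>The times at which none of the logarithms and divisions above takes a junk value.\<close>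

definition LJ_defined :: "real \<Rightarrow> (real \<Rightarrow> real) \<Rightarrow> real \<Rightarrow> bool" where
  "LJ_defined \<alpha> g t \<longleftrightarrow>
     G_fun \<alpha> g t > 0 \<and> ln (G_fun \<alpha> g t) \<noteq> 0 \<and> ln (L_fun \<alpha> g t) \<noteq> 0"

definition k0 :: "real \<Rightarrow> real" where
  "k0 \<alpha> = (\<alpha> + 1) * \<alpha> powr (- (\<alpha> / (\<alpha> + 1)))"

definition K0 :: "real \<Rightarrow> real" where
  "K0 \<alpha> = \<alpha> powr (1 / (\<alpha> + 1)) / (2 * (\<alpha> + 1))"

text \<open>\<open>I_fun \<alpha> g s y\<close> is meant for \<open>y \<ge> 0\<close>; the last three cases are those of \<open>y = 0\<close>.\<close>

definition I_fun :: "real \<Rightarrow> (real \<Rightarrow> real) \<Rightarrow> real \<Rightarrow> real \<Rightarrow> ereal" where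
  "I_fun \<alpha> g s y =
     (if y > 0 then ereal (g s / y powr \<alpha>)
      else if g s < 0 then - \<infinity>
      else if g s = 0 then 0
      else \<infinity>)"

text \<open>An extended-real-valued function is Lebesgue integrable iff it is finite almost everywhere
  and its real-valued modification is integrable; its integral is that of the modification.\<close>

definition ereal_integrable_on :: "(real \<Rightarrow> ereal) \<Rightarrow> real set \<Rightarrow> bool" where
  "ereal_integrable_on h S \<longleftrightarrow>
     (AE s in lebesgue. s \<in> S \<longrightarrow> \<bar>h s\<bar> \<noteq> \<infinity>) \<and>
     set_integrable lebesgue S (\<lambda>s. real_of_ereal (h s))"

definition ereal_integral :: "real set \<Rightarrow> (real \<Rightarrow> ereal) \<Rightarrow> real" where
  "ereal_integral S h = set_lebesgue_integral lebesgue S (\<lambda>s. real_of_ereal (h s))"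

definition is_solution ::
  "real \<Rightarrow> (real \<Rightarrow> real) \<Rightarrow> (real \<Rightarrow> real) \<Rightarrow> ereal \<Rightarrow> (real \<Rightarrow> real) \<Rightarrow> bool" where
  "is_solution \<alpha> f g \<delta> x \<longleftrightarrow>
     continuous_on {t. 0 \<le> t \<and> ereal t < \<delta>} x \<and>
     (\<forall>t. 0 \<le> t \<and> ereal t < \<delta> \<longrightarrow> 0 \<le> x t) \<and>
     (\<forall>K. compact K \<and> K \<subseteq> einterval 0 \<delta> \<longrightarrow> ereal_integrable_on (\<lambda>s. I_fun \<alpha> g s (x s)) K) \<and>
     (\<forall>t\<in>einterval 0 \<delta>. \<exists>l.
        ((\<lambda>\<epsilon>. ereal_integral {\<epsilon>..t} (\<lambda>s. I_fun \<alpha> g s (x s))) \<longlongrightarrow> l) (at_right 0) \<and>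
        x t = f t + l)"

definition is_pos_solution ::
  "real \<Rightarrow> (real \<Rightarrow> real) \<Rightarrow> (real \<Rightarrow> real) \<Rightarrow> real \<Rightarrow> ereal \<Rightarrow> (real \<Rightarrow> real) \<Rightarrow> bool" where
  "is_pos_solution \<alpha> f g \<mu> T x \<longleftrightarrow>
     continuous_on {t. 0 \<le> t \<and> ereal t < T} x \<and>
     (\<forall>t. 0 \<le> t \<and> ereal t < T \<longrightarrow>
        0 < x t \<and>
        set_integrable lebesgue {0..t} (\<lambda>s. g s * x s powr (- \<alpha>)) \<and>
        x t = \<mu> + f t + set_lebesgue_integral lebesgue {0..t} (\<lambda>s. g s * x s powr (- \<alpha>)))"

definition T_max :: "real \<Rightarrow> (real \<Rightarrow> real) \<Rightarrow> (real \<Rightarrow> real) \<Rightarrow> real \<Rightarrow> ereal" where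
  "T_max \<alpha> f g \<mu> = Sup {T. 0 < T \<and> (\<exists>x. is_pos_solution \<alpha> f g \<mu> T x)}"

text \<open>Positive solutions are unique only on their interval, hence \<open>SOME\<close> instead of \<open>THE\<close>: the
  values at \<open>t \<ge> T_max \<alpha> f g \<mu>\<close> are unspecified (and never used below).\<close>

definition x_mu :: "real \<Rightarrow> (real \<Rightarrow> real) \<Rightarrow> (real \<Rightarrow> real) \<Rightarrow> real \<Rightarrow> real \<Rightarrow> real" where
  "x_mu \<alpha> f g \<mu> = (SOME x. is_pos_solution \<alpha> f g \<mu> (T_max \<alpha> f g \<mu>) x)"

definition x_tilde :: "real \<Rightarrow> (real \<Rightarrow> real) \<Rightarrow> (real \<Rightarrow> real) \<Rightarrow> real \<Rightarrow> real" where
  "x_tilde \<alpha> f g t = Inf {x_mu \<alpha> f g \<mu> t | \<mu>. \<mu> > 0 \<and> T_max \<alpha> f g \<mu> > ereal t}"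

end

theory Submission
  imports Defs "HOL-Real_Asymp.Real_Asymp"
begin

text \<open>
  Put \<open>A(t) = \<integral>\<^sub>0\<^sup>t |g|\<close>, so that \<open>G = ((\<alpha> + 1) A) powr (1 / (\<alpha> + 1))\<close> near 0, and write
  \<open>deficit \<alpha> u\<close> for the claimed bound on \<open>f - x\<close> as a function of \<open>u = G(t)\<close>. Since
  \<open>G\<^sup>\<alpha> dG = |g| dt\<close>, the function \<open>v(t) = barrier \<alpha> (G t)\<close> with
  \<open>barrier \<alpha> u = u (deficit' \<alpha> u) powr (- 1 / \<alpha>)\<close> is made so that
  \<open>\<integral>\<^sub>0\<^sup>t |g| v powr (- \<alpha>) = deficit \<alpha> (G t)\<close> (lemma \<open>barrier_has_integral\<close>). Because \<open>g\<close> is merely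
  integrable, this change of variables is proved directly by cutting the interval into pieces on
  which the integrand is almost a multiple of \<open>|g|\<close> (lemma \<open>integral_chain_rule\<close>).

  The hypothesis on \<open>f\<close> makes \<open>v\<close> a subsolution, \<open>v \<le> f + \<integral> g v powr (- \<alpha>)\<close>. With
  \<open>L\<close> and \<open>J\<close> as in the statement, expand \<open>(deficit' \<alpha> u) powr (- 1 / \<alpha>)\<close> to second order. The
  constants \<open>k0\<close> and \<open>K0\<close> and the correction \<open>1 + J + J\<^sup>2\<close> in \<open>deficit\<close> are such that the terms of
  order \<open>1\<close> and \<open>L\<close> cancel, and so do the parts \<open>1\<close>, \<open>J\<close> and \<open>J\<^sup>2\<close> of the \<open>L\<^sup>2\<close> term.
  What remains is \<open>L\<^sup>2 (J\<^sup>3 - J\<^sup>4 / 2) + O(L\<^sup>3)\<close>, positive for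
  small \<open>u\<close> because \<open>L\<close> is smaller than every power of \<open>J\<close>. All dependence on \<open>\<alpha>\<close> cancels, so a single
  asymptotic inequality suffices (lemmas \<open>eventually_log_inequality\<close> and \<open>barrier_inequality\<close>).

  A subsolution carries the rest. As \<open>g \<le> 0\<close>, the nonlinearity is monotone, and every solution
  started from \<open>\<mu> + f\<close> with \<open>\<mu> > 0\<close> stays above \<open>v\<close>; in particular it exists on a common interval
  (lemma \<open>pos_sol_on_above_barrier\<close>, which solves an equation truncated at the level \<open>\<mu>\<close> and shows
  that the truncation is never active). These solutions decrease as \<open>\<mu>\<close> decreases to 0, and
  \<open>|g| v powr (- \<alpha>)\<close> dominates the integrands, so their limit \<open>x_tilde\<close> solves the equation and
  inherits \<open>x_tilde - f \<ge> - \<integral> |g| v powr (- \<alpha>)\<close> (lemma \<open>x_tilde_above_barrier\<close>).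

  Maximality is claimed on the whole domain of a competitor \<open>x\<close>, where \<open>g\<close> may change sign, so it
  cannot rest on monotonicity. Instead, at a first meeting point of \<open>x\<close> and a
  perturbed solution both are positive, so the nonlinearity is Lipschitz there and Gronwall's lemma, run backwards, makes them coincide before it (lemma
  \<open>strict_comparison\<close>).
\<close>

section \<open>Integrals of an integrable function times a continuous one\<close>

lemma absolutely_integrable_mult_continuous:
  fixes g \<phi> :: "real \<Rightarrow> real"
  assumes "g absolutely_integrable_on {a..b}" "continuous_on {a..b} \<phi>"
  shows "(\<lambda>s. g s * \<phi> s) absolutely_integrable_on {a..b}"
proof -
  have "(\<lambda>s. \<phi> s * g s) absolutely_integrable_on {a..b}"
  proof (rule absolutely_integrable_bounded_measurable_product_real)
    show "\<phi> \<in> borel_measurable (lebesgue_on {a..b})"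
      using assms(2) by (intro continuous_imp_measurable_on_sets_lebesgue) auto
    show "bounded (\<phi> ` {a..b})"
      using assms(2) compact_continuous_image compact_imp_bounded by blast
  qed (use assms in auto)
  then show ?thesis by (simp add: mult.commute)
qed

lemma abs_absolutely_integrable:
  fixes g :: "real \<Rightarrow> real"
  assumes "g absolutely_integrable_on S"
  shows "(\<lambda>s. \<bar>g s\<bar>) absolutely_integrable_on S"
  using absolutely_integrable_norm[OF assms] by (simp add: o_def)

lemma integral_diff_eq_integral:
  fixes f :: "real \<Rightarrow> real"
  assumes "f integrable_on {a..t}" "a \<le> s" "s \<le> t"
  shows "integral {a..t} f - integral {a..s} f = integral {s..t} f"
  using Henstock_Kurzweil_Integration.integral_combine[of a s t f] assms by simp

lemma small_integral_near_point:
  fixes k :: "real \<Rightarrow> real"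
  assumes k: "k absolutely_integrable_on {a..b}"
    and x: "a \<le> x" "x \<le> b" and e: "0 < e"
  obtains d where "0 < d"
    "\<And>s t. a \<le> s \<Longrightarrow> s \<le> x \<Longrightarrow> x \<le> t \<Longrightarrow> t \<le> b \<Longrightarrow> t - s < d \<Longrightarrow> integral {s..t} k < e"
proof -
  have ki: "k integrable_on {a..b}"
    using k absolutely_integrable_on_def by blast
  have "continuous_on {a..b} (\<lambda>t. integral {a..t} k)"
    by (rule indefinite_integral_continuous_1[OF ki])
  then obtain d where d: "0 < d"
    "\<And>t. t \<in> {a..b} \<Longrightarrow> dist t x < d \<Longrightarrow> dist (integral {a..t} k) (integral {a..x} k) < e/2"
    unfolding continuous_on_iff using x e by (meson atLeastAtMost_iff half_gt_zero)
  show ?thesis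
  proof (rule that[OF d(1)])
    fix s t assume st: "a \<le> s" "s \<le> x" "x \<le> t" "t \<le> b" "t - s < d"
    have "dist (integral {a..t} k) (integral {a..x} k) < e/2"
      "dist (integral {a..s} k) (integral {a..x} k) < e/2"
      using st d(2)[of t] d(2)[of s] by (auto simp: dist_real_def)
    moreover have "integral {a..t} k - integral {a..s} k = integral {s..t} k"
      using st by (intro integral_diff_eq_integral integrable_subinterval_real[OF ki]) auto
    ultimately show "integral {s..t} k < e"
      unfolding dist_real_def by linarith
  qed
qed

section \<open>A Gronwall lemma and integral equations with a Lipschitz nonlinearity\<close>

text \<open>Near each point the integral of \<open>k\<close> over a short interval is below \<open>1/2\<close>, so there a zero of \<open>d\<close>
  forces \<open>max |d| \<le> max |d| / 2\<close>, hence \<open>d = 0\<close>. The zero propagates from one short interval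
  to the next in both directions; backward propagation is what comparison needs later.\<close>
lemma integral_gronwall_zero:
  fixes d k :: "real \<Rightarrow> real"
  assumes k: "k absolutely_integrable_on {a..b}" and nn: "\<And>s. 0 \<le> k s"
    and d: "continuous_on {a..b} d"
    and incr: "\<And>s t. a \<le> s \<Longrightarrow> s \<le> t \<Longrightarrow> t \<le> b \<Longrightarrow>
                 \<bar>d t - d s\<bar> \<le> integral {s..t} (\<lambda>r. k r * \<bar>d r\<bar>)"
    and c: "c \<in> {a..b}" "d c = 0" and r: "r \<in> {a..b}"
  shows "d r = 0"
proof -
  define P where "P s t \<longleftrightarrow> (a \<le> s \<longrightarrow> t \<le> b \<longrightarrow>
      (\<exists>c\<in>{s..t}. d c = 0) \<longrightarrow> (\<forall>r\<in>{s..t}. d r = 0))" for s t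
  have "a \<le> b" using c by auto
  then have "P a b"
  proof (induction rule: Bolzano)
    case (trans u v w)
    show ?case
      unfolding P_def
    proof (intro impI)
      assume *: "a \<le> u" "w \<le> b" "\<exists>c\<in>{u..w}. d c = 0"
      then obtain c where c: "c \<in> {u..w}" "d c = 0" by blast
      have 1: "(\<exists>c\<in>{u..v}. d c = 0) \<Longrightarrow> (\<forall>r\<in>{u..v}. d r = 0)"
        using trans(1,4) * unfolding P_def by auto
      have 2: "(\<exists>c\<in>{v..w}. d c = 0) \<Longrightarrow> (\<forall>r\<in>{v..w}. d r = 0)"
        using trans(2,3) * unfolding P_def by auto
      have "d v = 0"
        using c 1 2 trans(3,4) by (metis atLeastAtMost_iff le_cases order_refl)
      then have "\<forall>r\<in>{u..v}. d r = 0" "\<forall>r\<in>{v..w}. d r = 0"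
        using 1 2 trans(3,4) by (metis atLeastAtMost_iff order_refl)+
      then show "\<forall>r\<in>{u..w}. d r = 0"
        by (metis atLeastAtMost_iff le_cases)
    qed
  next
    case (local x)
    obtain e where e: "0 < e"
      "\<And>s t. a \<le> s \<Longrightarrow> s \<le> x \<Longrightarrow> x \<le> t \<Longrightarrow> t \<le> b \<Longrightarrow> t - s < e \<Longrightarrow> integral {s..t} k < 1/2"
      using small_integral_near_point[OF k local, of "1/2"] by auto
    show ?case
    proof (intro exI[of _ e] conjI allI impI e(1))
      fix s t assume st: "s \<le> x \<and> x \<le> t \<and> t - s < e"
      show "P s t"
        unfolding P_def
      proof (intro impI)
        assume ab: "a \<le> s" "t \<le> b" "\<exists>c\<in>{s..t}. d c = 0"
        then obtain c where c: "c \<in> {s..t}" "d c = 0" by blast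
        have cont: "continuous_on {s..t} (\<lambda>r. \<bar>d r\<bar>)"
          using ab by (intro continuous_intros continuous_on_subset[OF d]) auto
        obtain m where m: "m \<in> {s..t}" "\<And>r. r \<in> {s..t} \<Longrightarrow> \<bar>d r\<bar> \<le> \<bar>d m\<bar>"
          using continuous_attains_sup[OF compact_Icc _ cont] c by fastforce
        have kst: "k absolutely_integrable_on {s..t}"
          using ab by (intro absolutely_integrable_on_subinterval[OF k]) auto
        have bnd: "\<bar>d v - d u\<bar> \<le> 1/2 * \<bar>d m\<bar>" if uv: "s \<le> u" "u \<le> v" "v \<le> t" for u v
        proof -
          have kuv: "k absolutely_integrable_on {u..v}"
            using uv by (intro absolutely_integrable_on_subinterval[OF kst]) auto
          have "continuous_on {u..v} (\<lambda>r. \<bar>d r\<bar>)"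
            using uv by (intro continuous_on_subset[OF cont]) auto
          then have i1: "(\<lambda>r. k r * \<bar>d r\<bar>) integrable_on {u..v}"
            using absolutely_integrable_mult_continuous[OF kuv] absolutely_integrable_on_def by blast
          have i2: "(\<lambda>r. k r * \<bar>d m\<bar>) integrable_on {u..v}"
            using kuv absolutely_integrable_on_def integrable_on_mult_left by blast
          have "\<bar>d v - d u\<bar> \<le> integral {u..v} (\<lambda>r. k r * \<bar>d r\<bar>)"
            using uv ab by (intro incr) auto
          also have "\<dots> \<le> integral {u..v} (\<lambda>r. k r * \<bar>d m\<bar>)"
            using uv nn m(2) by (intro integral_le i1 i2 mult_left_mono) auto
          also have "\<dots> = integral {u..v} k * \<bar>d m\<bar>"
            by (rule integral_mult_left)
          also have "integral {u..v} k \<le> integral {s..t} k"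
            using uv kst kuv nn absolutely_integrable_on_def by (intro integral_subset_le) auto
          then have "integral {u..v} k * \<bar>d m\<bar> \<le> integral {s..t} k * \<bar>d m\<bar>"
            by (intro mult_right_mono) auto
          also have "\<dots> \<le> 1/2 * \<bar>d m\<bar>"
            using e(2)[of s t] st ab by (intro mult_right_mono) auto
          finally show ?thesis .
        qed
        have "\<bar>d m\<bar> \<le> 1/2 * \<bar>d m\<bar>"
        proof (cases "c \<le> m")
          case True
          then show ?thesis using bnd[of c m] c m(1) by auto
        next
          case False
          then show ?thesis using bnd[of m c] c m(1) by auto
        qed
        then have "d m = 0" by auto
        then show "\<forall>r\<in>{s..t}. d r = 0" using m(2) by force
      qed
    qed
  qed
  then have "(\<exists>c\<in>{a..b}. d c = 0) \<longrightarrow> (\<forall>r\<in>{a..b}. d r = 0)"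
    unfolding P_def by simp
  then show ?thesis using c r by blast
qed

text \<open>Where \<open>|g|\<close> has small mass the integral operator is a contraction. Extending functions from
  \<open>{a..b}\<close> to the line by clamping the argument puts it on the complete space of bounded continuous
  functions.\<close>
lemma integral_equation_local_existence:
  fixes g h F :: "real \<Rightarrow> real"
  assumes ab: "a \<le> b" and g: "g absolutely_integrable_on {a..b}"
    and lip: "\<And>x y. \<bar>h x - h y\<bar> \<le> C * \<bar>x - y\<bar>" and C: "0 \<le> C"
    and small: "C * integral {a..b} (\<lambda>s. \<bar>g s\<bar>) \<le> 1/2"
    and F: "continuous_on {a..b} F"
  shows "\<exists>y. continuous_on {a..b} y \<and>
             (\<forall>t\<in>{a..b}. y t = F t + integral {a..t} (\<lambda>s. g s * h (y s)))"
proof -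
  define cl where "cl t = max a (min b t)" for t :: real
  have cl: "cl t \<in> {a..b}" "t \<in> {a..b} \<Longrightarrow> cl t = t" for t
    using ab by (auto simp: cl_def)
  have clc: "continuous_on UNIV cl"
    unfolding cl_def by (intro continuous_intros)
  have hc: "continuous_on UNIV h"
  proof -
    have "C-lipschitz_on UNIV h"
      using lip C by (intro lipschitz_onI) (auto simp: dist_real_def)
    then show ?thesis by (rule lipschitz_on_continuous_on)
  qed
  define op where "op y t = F (cl t) + integral {a..cl t} (\<lambda>s. g s * h (y s))"
    for y :: "real \<Rightarrow> real" and t
  have ghy: "(\<lambda>s. g s * h (apply_bcontfun y s)) absolutely_integrable_on {a..b}" for y
    by (intro absolutely_integrable_mult_continuous[OF g]
          continuous_on_compose2[OF hc continuous_on_apply_bcontfun]) auto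
  have opc: "op (apply_bcontfun y) \<in> bcontfun" for y :: "real \<Rightarrow>\<^sub>C real"
  proof -
    have c: "continuous_on {a..b} (\<lambda>t. F t + integral {a..t} (\<lambda>s. g s * h (apply_bcontfun y s)))"
      using ghy[of y] absolutely_integrable_on_def
      by (intro continuous_intros F indefinite_integral_continuous_1) blast
    have "continuous_on UNIV (op (apply_bcontfun y))"
      unfolding op_def using cl
      by (intro continuous_on_compose2[OF c clc]) auto
    moreover have "bounded (range (op (apply_bcontfun y)))"
    proof -
      have "bounded ((\<lambda>t. F t + integral {a..t} (\<lambda>s. g s * h (apply_bcontfun y s))) ` {a..b})"
        by (intro compact_imp_bounded compact_continuous_image c) auto
      then show ?thesis
        by (rule bounded_subset) (use cl in \<open>auto simp: op_def\<close>)
    qed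
    ultimately show ?thesis unfolding bcontfun_def by auto
  qed
  define OP where "OP y = Bcontfun (op (apply_bcontfun y))" for y
  have OP: "apply_bcontfun (OP y) = op (apply_bcontfun y)" for y
    unfolding OP_def by (rule Bcontfun_inverse[OF opc])
  have contr: "dist (OP y) (OP z) \<le> 1/2 * dist y z" for y z
  proof (rule dist_bound)
    fix t
    let ?c = "cl t"
    have sub: "{a..?c} \<subseteq> {a..b}" using cl by auto
    have i: "(\<lambda>s. g s * h (apply_bcontfun y s)) integrable_on {a..?c}" for y
      using absolutely_integrable_on_subinterval[OF ghy sub] absolutely_integrable_on_def by blast
    have ga: "(\<lambda>s. \<bar>g s\<bar>) absolutely_integrable_on {a..b}"
      by (rule abs_absolutely_integrable[OF g])
    have ga': "(\<lambda>s. \<bar>g s\<bar>) integrable_on {a..?c}" "(\<lambda>s. \<bar>g s\<bar>) integrable_on {a..b}"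
      using absolutely_integrable_on_subinterval[OF ga sub] ga absolutely_integrable_on_def by blast+
    have "dist (apply_bcontfun (OP y) t) (apply_bcontfun (OP z) t) =
        \<bar>integral {a..?c} (\<lambda>s. g s * h (apply_bcontfun y s)) -
         integral {a..?c} (\<lambda>s. g s * h (apply_bcontfun z s))\<bar>"
      by (simp add: OP op_def dist_real_def)
    also have "\<dots> = \<bar>integral {a..?c} (\<lambda>s. g s * h (apply_bcontfun y s) - g s * h (apply_bcontfun z s))\<bar>"
      by (subst integral_diff[OF i i]) auto
    also have "\<dots> \<le> integral {a..?c} (\<lambda>s. \<bar>g s\<bar> * (C * dist y z))"
    proof -
      have "norm (integral {a..?c} (\<lambda>s. g s * h (apply_bcontfun y s) - g s * h (apply_bcontfun z s)))
            \<le> integral {a..?c} (\<lambda>s. \<bar>g s\<bar> * (C * dist y z))"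
      proof (rule Henstock_Kurzweil_Integration.integral_norm_bound_integral)
        fix s
        have "\<bar>h (apply_bcontfun y s) - h (apply_bcontfun z s)\<bar> \<le> C * dist y z"
          by (rule order_trans[OF lip mult_left_mono[OF _ C]])
             (metis dist_bounded dist_real_def)
        then show "norm (g s * h (apply_bcontfun y s) - g s * h (apply_bcontfun z s))
             \<le> \<bar>g s\<bar> * (C * dist y z)"
          by (simp add: right_diff_distrib[symmetric] abs_mult mult_left_mono)
      qed (use i ga' in \<open>auto intro!: integrable_diff integrable_on_mult_left\<close>)
      then show ?thesis by simp
    qed
    also have "\<dots> = integral {a..?c} (\<lambda>s. \<bar>g s\<bar>) * (C * dist y z)"
      by (rule integral_mult_left)
    also have "\<dots> \<le> integral {a..b} (\<lambda>s. \<bar>g s\<bar>) * (C * dist y z)"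
      using ga' sub C by (intro mult_right_mono integral_subset_le) auto
    also have "\<dots> = (C * integral {a..b} (\<lambda>s. \<bar>g s\<bar>)) * dist y z"
      by simp
    also have "\<dots> \<le> 1/2 * dist y z"
      by (rule mult_right_mono[OF small]) auto
    finally show "dist (apply_bcontfun (OP y) t) (apply_bcontfun (OP z) t) \<le> 1/2 * dist y z" .
  qed
  obtain y where y: "OP y = y"
    using banach_fix_type[of "1/2" OP] contr by auto
  have "apply_bcontfun y t = F t + integral {a..t} (\<lambda>s. g s * h (apply_bcontfun y s))"
    if "t \<in> {a..b}" for t
    using fun_cong[OF OP[of y], of t] cl(2)[OF that] by (simp add: y op_def)
  then show ?thesis
    by (intro exI[of _ "apply_bcontfun y"]) auto
qed

text \<open>Local solutions are glued: the solution on the left piece enters the equation on the right piece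
  as a constant added to \<open>F\<close>. Quantifying over all forcing terms \<open>F\<close> makes this induction work.\<close>
lemma integral_equation_existence:
  fixes g h F :: "real \<Rightarrow> real"
  assumes ab: "a \<le> b" and g: "g absolutely_integrable_on {a..b}"
    and lip: "\<And>x y. \<bar>h x - h y\<bar> \<le> C * \<bar>x - y\<bar>"
    and F: "continuous_on {a..b} F"
  shows "\<exists>y. continuous_on {a..b} y \<and>
             (\<forall>t\<in>{a..b}. y t = F t + integral {a..t} (\<lambda>s. g s * h (y s)))"
proof -
  have C: "0 \<le> C" using abs_ge_zero[of "h 1 - h 0"] lip[of 1 0] by simp
  have hc: "continuous_on UNIV h"
  proof -
    have "C-lipschitz_on UNIV h"
      using lip C by (intro lipschitz_onI) (auto simp: dist_real_def)
    then show ?thesis by (rule lipschitz_on_continuous_on)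
  qed
  define P where "P u v \<longleftrightarrow> (a \<le> u \<longrightarrow> u \<le> v \<longrightarrow> v \<le> b \<longrightarrow>
      (\<forall>F. continuous_on {u..v} F \<longrightarrow> (\<exists>y. continuous_on {u..v} y \<and>
             (\<forall>t\<in>{u..v}. y t = F t + integral {u..t} (\<lambda>s. g s * h (y s))))))" for u v
  from ab have "P a b"
  proof (induction rule: Bolzano)
    case (trans u v w)
    show ?case
      unfolding P_def
    proof (intro impI allI)
      fix F :: "real \<Rightarrow> real"
      assume *: "a \<le> u" "u \<le> w" "w \<le> b" and F: "continuous_on {u..w} F"
      have F1: "continuous_on {u..v} F"
        using trans(4) by (intro continuous_on_subset[OF F]) auto
      obtain y1 where y1: "continuous_on {u..v} y1"
        "\<And>t. t \<in> {u..v} \<Longrightarrow> y1 t = F t + integral {u..t} (\<lambda>s. g s * h (y1 s))"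
        using trans(1)[unfolded P_def, rule_format, OF _ _ _ F1] trans(3,4) * by force
      let ?I = "integral {u..v} (\<lambda>s. g s * h (y1 s))"
      have F2: "continuous_on {v..w} (\<lambda>t. F t + ?I)"
        using trans(3) by (intro continuous_intros continuous_on_subset[OF F]) auto
      obtain y2 where y2: "continuous_on {v..w} y2"
        "\<And>t. t \<in> {v..w} \<Longrightarrow> y2 t = F t + ?I + integral {v..t} (\<lambda>s. g s * h (y2 s))"
        using trans(2)[unfolded P_def, rule_format, OF _ _ _ F2] trans(3,4) * by force
      define y where "y t = (if t \<le> v then y1 t else y2 t)" for t
      have eqv: "y1 v = y2 v"
        using y1(2)[of v] y2(2)[of v] trans(3,4) by auto
      have yc: "continuous_on {u..w} y"
      proof -
        have "{u..w} = {u..v} \<union> {v..w}" using trans(3,4) by auto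
        moreover have "continuous_on ({u..v} \<union> {v..w}) y"
          unfolding y_def using eqv
          by (intro continuous_on_cases y1(1) y2(1)) auto
        ultimately show ?thesis by simp
      qed
      have ghy: "(\<lambda>s. g s * h (y s)) integrable_on {u..w}"
      proof -
        have "g absolutely_integrable_on {u..w}"
          using * by (intro absolutely_integrable_on_subinterval[OF g]) auto
        then have "(\<lambda>s. g s * h (y s)) absolutely_integrable_on {u..w}"
          by (intro absolutely_integrable_mult_continuous
              continuous_on_compose2[OF hc yc]) auto
        then show ?thesis using absolutely_integrable_on_def by blast
      qed
      have e1: "integral {u..t} (\<lambda>s. g s * h (y s)) = integral {u..t} (\<lambda>s. g s * h (y1 s))"
        if "t \<le> v" for t
        by (rule integral_cong) (use that in \<open>auto simp: y_def\<close>)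
      have e2: "integral {v..t} (\<lambda>s. g s * h (y s)) = integral {v..t} (\<lambda>s. g s * h (y2 s))" for t
        by (rule integral_cong) (use eqv in \<open>auto simp: y_def\<close>)
      have "y t = F t + integral {u..t} (\<lambda>s. g s * h (y s))" if t: "t \<in> {u..w}" for t
      proof (cases "t \<le> v")
        case True
        then show ?thesis using y1(2)[of t] t e1[of t] by (simp add: y_def)
      next
        case False
        have "integral {u..v} (\<lambda>s. g s * h (y s)) + integral {v..t} (\<lambda>s. g s * h (y s))
              = integral {u..t} (\<lambda>s. g s * h (y s))"
          using False t trans(3,4)
          by (intro Henstock_Kurzweil_Integration.integral_combine
              integrable_subinterval_real[OF ghy]) auto
        then show ?thesis using False t y2(2)[of t] e1[of v] e2[of t] by (simp add: y_def)
      qed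
      with yc show "\<exists>y. continuous_on {u..w} y \<and>
             (\<forall>t\<in>{u..w}. y t = F t + integral {u..t} (\<lambda>s. g s * h (y s)))" by blast
    qed
  next
    case (local x)
    have ga: "(\<lambda>s. \<bar>g s\<bar>) absolutely_integrable_on {a..b}"
      by (rule abs_absolutely_integrable[OF g])
    obtain e where e: "0 < e"
      "\<And>s t. a \<le> s \<Longrightarrow> s \<le> x \<Longrightarrow> x \<le> t \<Longrightarrow> t \<le> b \<Longrightarrow> t - s < e \<Longrightarrow>
          integral {s..t} (\<lambda>s. \<bar>g s\<bar>) < 1 / (2 * (C + 1))"
      using small_integral_near_point[OF ga local, of "1 / (2 * (C + 1))"] C by auto
    show ?case
    proof (intro exI[of _ e] conjI allI impI e(1))
      fix s t assume st: "s \<le> x \<and> x \<le> t \<and> t - s < e"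
      show "P s t"
        unfolding P_def
      proof (intro impI allI)
        fix F :: "real \<Rightarrow> real"
        assume *: "a \<le> s" "s \<le> t" "t \<le> b" and F: "continuous_on {s..t} F"
        have "C * integral {s..t} (\<lambda>s. \<bar>g s\<bar>) \<le> C * (1 / (2 * (C + 1)))"
          using e(2)[of s t] st * C by (intro mult_left_mono) auto
        also have "\<dots> \<le> 1/2" using C by (simp add: field_simps)
        finally have sm: "C * integral {s..t} (\<lambda>s. \<bar>g s\<bar>) \<le> 1/2" .
        have "g absolutely_integrable_on {s..t}"
          using * by (intro absolutely_integrable_on_subinterval[OF g]) auto
        from integral_equation_local_existence[OF *(2) this lip C sm F]
        show "\<exists>y. continuous_on {s..t} y \<and>
             (\<forall>t\<in>{s..t}. y t = F t + integral {s..t} (\<lambda>s. g s * h (y s)))" .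
      qed
    qed
  qed
  then have "\<forall>F. continuous_on {a..b} F \<longrightarrow> (\<exists>y. continuous_on {a..b} y \<and>
             (\<forall>t\<in>{a..b}. y t = F t + integral {a..t} (\<lambda>s. g s * h (y s))))"
    unfolding P_def using ab by simp
  then show ?thesis using F by simp
qed

text \<open>Otherwise there is a first point at which \<open>d\<close> is not positive.\<close>
lemma positive_by_first_zero:
  fixes d :: "real \<Rightarrow> real"
  assumes d: "continuous_on {0..b} d" and d0: "0 < d 0"
    and step: "\<And>t. 0 < t \<Longrightarrow> t \<le> b \<Longrightarrow> (\<And>s. 0 \<le> s \<Longrightarrow> s < t \<Longrightarrow> 0 < d s) \<Longrightarrow> 0 < d t"
    and t: "t \<in> {0..b}"
  shows "0 < d t"
proof (rule ccontr)
  assume neg: "\<not> 0 < d t"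
  define Z where "Z = {0..b} \<inter> d -` {..0}"
  have "closed Z"
    unfolding Z_def by (intro continuous_closed_preimage d) auto
  moreover have "bounded Z" unfolding Z_def by (rule bounded_subset[of "{0..b}"]) auto
  ultimately have "compact Z" by (simp add: compact_eq_bounded_closed)
  moreover have "t \<in> Z" using neg t by (auto simp: Z_def)
  ultimately obtain z where z: "z \<in> Z" "\<And>s. s \<in> Z \<Longrightarrow> z \<le> s"
    using compact_attains_inf[of Z] by auto
  have "z > 0" using z(1) d0 unfolding Z_def by (cases "z = 0") auto
  then have "0 < d z"
  proof (rule step)
    show "z \<le> b" using z(1) by (auto simp: Z_def)
    fix s assume s: "0 \<le> s" "s < z"
    show "0 < d s"
    proof (rule ccontr)
      assume "\<not> 0 < d s"
      then have "s \<in> Z" using s z(1) by (auto simp: Z_def)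
      then show False using z(2) s by force
    qed
  qed
  then show False using z(1) by (auto simp: Z_def)
qed

lemma powr_neg_lipschitz:
  fixes \<alpha> m x y :: real
  assumes "0 < \<alpha>" "0 < m" "m \<le> x" "m \<le> y"
  shows "\<bar>x powr (-\<alpha>) - y powr (-\<alpha>)\<bar> \<le> \<alpha> * m powr (-\<alpha>-1) * \<bar>x - y\<bar>"
proof -
  have "norm (x powr (-\<alpha>) - y powr (-\<alpha>)) \<le> (\<alpha> * m powr (-\<alpha>-1)) * norm (x - y)"
  proof (rule field_differentiable_bound[where S="{m..}" and f="\<lambda>z. z powr (-\<alpha>)"
          and f'="\<lambda>z. -\<alpha> * z powr (-\<alpha>-1)"])
    show "convex {m..}" by (rule convex_real_interval)
  next
    fix z assume z: "z \<in> {m..}"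
    show "((\<lambda>z. z powr (-\<alpha>)) has_field_derivative (-\<alpha> * z powr (-\<alpha>-1))) (at z within {m..})"
      by (rule has_field_derivative_at_within, rule has_real_derivative_powr) (use z assms in auto)
  next
    fix z assume z: "z \<in> {m..}"
    then have "z powr (- \<alpha> - 1) \<le> m powr (- \<alpha> - 1)"
      using assms by (intro powr_mono2') auto
    then show "norm (- \<alpha> * z powr (- \<alpha> - 1)) \<le> \<alpha> * m powr (- \<alpha> - 1)"
      using assms by (simp add: abs_mult)
  next
    show "x \<in> {m..}" "y \<in> {m..}" using assms by auto
  qed
  then show ?thesis by simp
qed

section \<open>Positive solutions and comparison\<close>

text \<open>The form of \<open>is_pos_solution\<close> on a compact interval. Integrability of the right-hand side is automatic there,
  since a continuous positive function is bounded away from 0.\<close>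
definition pos_sol_on ::
  "real \<Rightarrow> (real \<Rightarrow> real) \<Rightarrow> (real \<Rightarrow> real) \<Rightarrow> real \<Rightarrow> real \<Rightarrow> (real \<Rightarrow> real) \<Rightarrow> bool" where
  "pos_sol_on \<alpha> f g \<mu> b x \<longleftrightarrow>
     continuous_on {0..b} x \<and> (\<forall>t\<in>{0..b}. 0 < x t) \<and>
     (\<forall>t\<in>{0..b}. x t = \<mu> + f t + integral {0..t} (\<lambda>s. g s * x s powr (- \<alpha>)))"

lemma absolutely_integrable_mult_powr:
  fixes g x :: "real \<Rightarrow> real"
  assumes "g absolutely_integrable_on {a..b}" "continuous_on {a..b} x" "\<And>t. t \<in> {a..b} \<Longrightarrow> 0 < x t"
  shows "(\<lambda>s. g s * x s powr (- \<alpha>)) absolutely_integrable_on {a..b}"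
  using assms(3)
  by (intro absolutely_integrable_mult_continuous assms(1) continuous_intros assms(2)) force

lemma continuous_on_half_openI:
  fixes x :: "real \<Rightarrow> real" and T :: ereal
  assumes "\<And>b. 0 \<le> b \<Longrightarrow> ereal b < T \<Longrightarrow> continuous_on {0..b} x"
  shows "continuous_on {t. 0 \<le> t \<and> ereal t < T} x"
  unfolding continuous_on_eq_continuous_within
proof
  fix t assume "t \<in> {t. 0 \<le> t \<and> ereal t < T}"
  then have t: "0 \<le> t" "ereal t < T" by auto
  obtain b where b: "t < b" "ereal b < T"
    using ereal_dense2[OF t(2)] by auto
  have "continuous (at t within {0..b}) x"
    using assms[of b] b t by (auto simp: continuous_on_eq_continuous_within)
  moreover have "at t within {0..b} = at t within {t. 0 \<le> t \<and> ereal t < T}"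
  proof (rule at_within_nhd[of _ "{..<b}"])
    have "ereal r < T" if "r < b" for r
      using that b(2) by (meson ereal_less_eq(3) le_less_trans less_imp_le)
    then show "{0..b} \<inter> {..<b} - {t} = {t. 0 \<le> t \<and> ereal t < T} \<inter> {..<b} - {t}"
      by auto
  qed (use b in auto)
  ultimately show "continuous (at t within {t. 0 \<le> t \<and> ereal t < T}) x" by simp
qed

lemma pos_sol_on_restrict:
  assumes "is_pos_solution \<alpha> f g \<mu> T x" "ereal b < T"
  shows "pos_sol_on \<alpha> f g \<mu> b x"
proof -
  have lt: "ereal t < T" if "t \<le> b" for t
    using that assms(2) by (meson ereal_less_eq(3) le_less_trans)
  have "continuous_on {t. 0 \<le> t \<and> ereal t < T} x"
    using assms(1) unfolding is_pos_solution_def by blast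
  then have "continuous_on {0..b} x"
    by (rule continuous_on_subset) (use lt in auto)
  moreover have "0 < x t" "x t = \<mu> + f t + integral {0..t} (\<lambda>s. g s * x s powr (- \<alpha>))"
    if "t \<in> {0..b}" for t
    using assms(1) that lt[of t] unfolding is_pos_solution_def
    by (auto simp: set_lebesgue_integral_eq_integral(2)[symmetric])
  ultimately show ?thesis unfolding pos_sol_on_def by blast
qed

lemma is_pos_solutionI:
  assumes g: "\<And>b. g absolutely_integrable_on {0..b}"
    and x: "\<And>b. 0 \<le> b \<Longrightarrow> ereal b < T \<Longrightarrow> pos_sol_on \<alpha> f g \<mu> b x"
  shows "is_pos_solution \<alpha> f g \<mu> T x"
  unfolding is_pos_solution_def
proof (intro conjI allI impI)
  show "continuous_on {t. 0 \<le> t \<and> ereal t < T} x"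
    using x by (intro continuous_on_half_openI) (auto simp: pos_sol_on_def)
  fix t assume t: "0 \<le> t \<and> ereal t < T"
  then have p: "pos_sol_on \<alpha> f g \<mu> t x" using x by auto
  then show "0 < x t" using t by (auto simp: pos_sol_on_def)
  show i: "set_integrable lebesgue {0..t} (\<lambda>s. g s * x s powr (- \<alpha>))"
    using p by (intro absolutely_integrable_mult_powr g) (auto simp: pos_sol_on_def)
  show "x t = \<mu> + f t + set_lebesgue_integral lebesgue {0..t} (\<lambda>s. g s * x s powr (- \<alpha>))"
    using p t by (auto simp: pos_sol_on_def set_lebesgue_integral_eq_integral(2)[OF i])
qed

lemma pos_sol_on_subinterval:
  assumes "pos_sol_on \<alpha> f g \<mu> b x" "c \<le> b"
  shows "pos_sol_on \<alpha> f g \<mu> c x"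
  using assms unfolding pos_sol_on_def by (auto intro: continuous_on_subset)

lemma pos_sol_on_increment:
  assumes g: "\<And>b. g absolutely_integrable_on {0..b}"
    and x: "pos_sol_on \<alpha> f g \<mu> b x" and st: "0 \<le> s" "s \<le> t" "t \<le> b"
  shows "x t - x s - (f t - f s) = integral {s..t} (\<lambda>r. g r * x r powr (- \<alpha>))"
proof -
  have "(\<lambda>r. g r * x r powr (- \<alpha>)) absolutely_integrable_on {0..t}"
    using x st
    by (intro absolutely_integrable_mult_powr g) (auto simp: pos_sol_on_def intro: continuous_on_subset)
  then have "(\<lambda>r. g r * x r powr (- \<alpha>)) integrable_on {0..t}"
    using absolutely_integrable_on_def by blast
  from integral_diff_eq_integral[OF this st(1,2)] x st show ?thesis
    unfolding pos_sol_on_def by auto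
qed

text \<open>On a compact interval both functions stay above some \<open>m > 0\<close>, where \<open>y powr (- \<alpha>)\<close> is Lipschitz.
  The equation is stated for increments and the meeting point may be anywhere in the interval, so the
  lemma gives forward uniqueness (from the left end) and backward uniqueness (from the right end).\<close>
lemma positive_solutions_agree:
  fixes p q f g :: "real \<Rightarrow> real"
  assumes \<alpha>: "0 < \<alpha>" and g: "g absolutely_integrable_on {a..b}"
    and p: "continuous_on {a..b} p" "\<And>t. t \<in> {a..b} \<Longrightarrow> 0 < p t"
    and q: "continuous_on {a..b} q" "\<And>t. t \<in> {a..b} \<Longrightarrow> 0 < q t"
    and pi: "\<And>s t. a \<le> s \<Longrightarrow> s \<le> t \<Longrightarrow> t \<le> b \<Longrightarrow>
        p t - p s - (f t - f s) = integral {s..t} (\<lambda>r. g r * p r powr (- \<alpha>))"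
    and qi: "\<And>s t. a \<le> s \<Longrightarrow> s \<le> t \<Longrightarrow> t \<le> b \<Longrightarrow>
        q t - q s - (f t - f s) = integral {s..t} (\<lambda>r. g r * q r powr (- \<alpha>))"
    and c: "c \<in> {a..b}" "p c = q c" and r: "r \<in> {a..b}"
  shows "p r = q r"
proof -
  have cm: "continuous_on {a..b} (\<lambda>t. min (p t) (q t))"
    by (intro continuous_intros p q)
  have ne: "{a..b} \<noteq> {}" using c by auto
  obtain m0 where m0: "m0 \<in> {a..b}"
    "\<And>t. t \<in> {a..b} \<Longrightarrow> min (p m0) (q m0) \<le> min (p t) (q t)"
    using continuous_attains_inf[OF compact_Icc ne cm] by blast
  define m where "m = min (p m0) (q m0)"
  have m: "0 < m" "\<And>t. t \<in> {a..b} \<Longrightarrow> m \<le> p t" "\<And>t. t \<in> {a..b} \<Longrightarrow> m \<le> q t"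
    unfolding m_def using p(2)[OF m0(1)] q(2)[OF m0(1)] m0(2) by auto
  define C where "C = \<alpha> * m powr (-\<alpha>-1)"
  have C: "0 \<le> C" unfolding C_def using \<alpha> by auto
  have "p r - q r = 0"
  proof (rule integral_gronwall_zero[where k="\<lambda>s. \<bar>g s\<bar> * C" and d="\<lambda>t. p t - q t"])
    show kk: "(\<lambda>s. \<bar>g s\<bar> * C) absolutely_integrable_on {a..b}"
      by (rule absolutely_integrable_mult_continuous[OF abs_absolutely_integrable[OF g]]) auto
    show "0 \<le> \<bar>g s\<bar> * C" for s using C by auto
    show cd: "continuous_on {a..b} (\<lambda>t. p t - q t)" by (intro continuous_intros p q)
    show "c \<in> {a..b}" "r \<in> {a..b}" "p c - q c = 0" using c r by auto
    fix s t assume st: "a \<le> s" "s \<le> t" "t \<le> b"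
    have sub: "{s..t} \<subseteq> {a..b}" using st by auto
    have g': "g absolutely_integrable_on {s..t}"
      by (rule absolutely_integrable_on_subinterval[OF g sub])
    have ip: "(\<lambda>r. g r * p r powr (- \<alpha>)) integrable_on {s..t}"
      using absolutely_integrable_mult_powr[OF g' continuous_on_subset[OF p(1) sub]] p(2) sub
        absolutely_integrable_on_def by blast
    have iq: "(\<lambda>r. g r * q r powr (- \<alpha>)) integrable_on {s..t}"
      using absolutely_integrable_mult_powr[OF g' continuous_on_subset[OF q(1) sub]] q(2) sub
        absolutely_integrable_on_def by blast
    have "continuous_on {s..t} (\<lambda>r. \<bar>p r - q r\<bar>)"
      by (intro continuous_on_rabs continuous_on_subset[OF cd sub])
    from absolutely_integrable_mult_continuous[OF absolutely_integrable_on_subinterval[OF kk sub] this]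
    have ik: "(\<lambda>r. \<bar>g r\<bar> * C * \<bar>p r - q r\<bar>) integrable_on {s..t}"
      using absolutely_integrable_on_def by blast
    have "(p t - q t) - (p s - q s) =
        integral {s..t} (\<lambda>r. g r * p r powr (- \<alpha>)) - integral {s..t} (\<lambda>r. g r * q r powr (- \<alpha>))"
      using pi[OF st] qi[OF st] by linarith
    also have "\<dots> = integral {s..t} (\<lambda>r. g r * p r powr (- \<alpha>) - g r * q r powr (- \<alpha>))"
      by (rule integral_diff[OF ip iq, symmetric])
    finally have eq: "(p t - q t) - (p s - q s) =
        integral {s..t} (\<lambda>r. g r * p r powr (- \<alpha>) - g r * q r powr (- \<alpha>))" .
    have "norm (integral {s..t} (\<lambda>r. g r * p r powr (- \<alpha>) - g r * q r powr (- \<alpha>)))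
        \<le> integral {s..t} (\<lambda>r. \<bar>g r\<bar> * C * \<bar>p r - q r\<bar>)"
    proof (rule Henstock_Kurzweil_Integration.integral_norm_bound_integral)
      fix u assume "u \<in> {s..t}"
      then have u: "u \<in> {a..b}" using sub by auto
      have "\<bar>p u powr (- \<alpha>) - q u powr (- \<alpha>)\<bar> \<le> C * \<bar>p u - q u\<bar>"
        unfolding C_def by (rule powr_neg_lipschitz) (use \<alpha> m u in auto)
      then have "\<bar>g u\<bar> * \<bar>p u powr (- \<alpha>) - q u powr (- \<alpha>)\<bar> \<le> \<bar>g u\<bar> * (C * \<bar>p u - q u\<bar>)"
        by (intro mult_left_mono) auto
      then show "norm (g u * p u powr (- \<alpha>) - g u * q u powr (- \<alpha>)) \<le> \<bar>g u\<bar> * C * \<bar>p u - q u\<bar>"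
        by (simp add: right_diff_distrib[symmetric] abs_mult mult.assoc)
    qed (use ip iq ik in \<open>auto intro: integrable_diff\<close>)
    then show "\<bar>p t - q t - (p s - q s)\<bar> \<le> integral {s..t} (\<lambda>r. \<bar>g r\<bar> * C * \<bar>p r - q r\<bar>)"
      using eq by simp
  qed
  then show ?thesis by simp
qed

lemma pos_sol_on_unique:
  assumes \<alpha>: "0 < \<alpha>" and g: "\<And>b. g absolutely_integrable_on {0..b}"
    and x: "pos_sol_on \<alpha> f g \<mu> b x" and y: "pos_sol_on \<alpha> f g \<mu> b y" and t: "t \<in> {0..b}"
  shows "x t = y t"
proof (rule positive_solutions_agree[where f=f and c=0 and a=0 and b=b and p=x and q=y and g=g, OF \<alpha> g])
  show "x 0 = y 0" using x y t by (auto simp: pos_sol_on_def)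
qed (use x y t pos_sol_on_increment[OF g x] pos_sol_on_increment[OF g y] in \<open>auto simp: pos_sol_on_def\<close>)

text \<open>At a first meeting point \<open>t\<close> one has \<open>p t = q t > 0\<close>, so \<open>p\<close> is positive on some \<open>{s..t}\<close>. There
  the two solutions agree at \<open>t\<close>, hence on the whole of \<open>{s..t}\<close>, although \<open>p < q\<close> before \<open>t\<close>. The
  function \<open>p\<close> may vanish elsewhere, which is why its equation is required only where it is
  positive.\<close>
lemma strict_comparison:
  fixes p q f g :: "real \<Rightarrow> real"
  assumes \<alpha>: "0 < \<alpha>" and g: "g absolutely_integrable_on {0..b}"
    and p: "continuous_on {0..b} p"
    and q: "continuous_on {0..b} q" "\<And>t. t \<in> {0..b} \<Longrightarrow> 0 < q t"
    and pi: "\<And>s t. 0 < s \<Longrightarrow> s \<le> t \<Longrightarrow> t \<le> b \<Longrightarrow> (\<And>r. r \<in> {s..t} \<Longrightarrow> 0 < p r) \<Longrightarrow>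
        p t - p s - (f t - f s) = integral {s..t} (\<lambda>r. g r * p r powr (- \<alpha>))"
    and qi: "\<And>s t. 0 < s \<Longrightarrow> s \<le> t \<Longrightarrow> t \<le> b \<Longrightarrow>
        q t - q s - (f t - f s) = integral {s..t} (\<lambda>r. g r * q r powr (- \<alpha>))"
    and 0: "p 0 < q 0" and t: "t \<in> {0..b}"
  shows "p t < q t"
proof -
  have "0 < q t - p t"
  proof (rule positive_by_first_zero[where d="\<lambda>t. q t - p t" and b=b])
    show cd: "continuous_on {0..b} (\<lambda>t. q t - p t)" by (intro continuous_intros p q)
    fix t assume t: "0 < t" "t \<le> b" and before: "\<And>s. 0 \<le> s \<Longrightarrow> s < t \<Longrightarrow> 0 < q s - p s"
    show "0 < q t - p t"
    proof (rule ccontr)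
      assume "\<not> 0 < q t - p t"
      moreover have "continuous_on {0..t} (\<lambda>t. q t - p t)"
        using t by (intro continuous_on_subset[OF cd]) auto
      ultimately obtain z where z: "0 \<le> z" "z \<le> t" "q z - p z = 0"
        using IVT2'[of "\<lambda>t. q t - p t" t 0 0] 0 t by auto
      then have eq: "p t = q t"
        using before[of z] by (cases "z = t") auto
      have pt: "0 < p t" using eq q(2) t by auto
      obtain e where e: "0 < e" "\<And>s. s \<in> {0..b} \<Longrightarrow> dist s t < e \<Longrightarrow> dist (p s) (p t) < p t"
        using p pt t unfolding continuous_on_iff by (meson atLeastAtMost_iff less_imp_le)
      \<comment> \<open>\<open>s\<close> has to be positive: the equation for \<open>p\<close> is available only away from 0.\<close>
      define s where "s = max (t/2) (t - e/2)"
      have s: "0 < s" "s < t" "t - s < e" using t e(1) by (auto simp: s_def max_def)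
      have pp: "0 < p r" if "r \<in> {s..t}" for r
      proof -
        have "dist (p r) (p t) < p t"
          using that s t by (intro e(2)) (auto simp: dist_real_def)
        then show ?thesis unfolding dist_real_def by linarith
      qed
      have sub: "{s..t} \<subseteq> {0..b}" using s t by auto
      have "p s = q s"
      proof (rule positive_solutions_agree[OF \<alpha>, where a=s and b=t and f=f and g=g and c=t
              and p=p and q=q])
        show "g absolutely_integrable_on {s..t}"
          by (rule absolutely_integrable_on_subinterval[OF g sub])
        show "continuous_on {s..t} p" "continuous_on {s..t} q"
          using continuous_on_subset[OF p sub] continuous_on_subset[OF q(1) sub] by auto
        show "0 < p r" if "r \<in> {s..t}" for r using pp that .
        show "0 < q r" if "r \<in> {s..t}" for r using q(2) that sub by auto
        show "p v - p u - (f v - f u) = integral {u..v} (\<lambda>r. g r * p r powr - \<alpha>)"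
          if "s \<le> u" "u \<le> v" "v \<le> t" for u v
          using that s t pp by (intro pi) auto
        show "q v - q u - (f v - f u) = integral {u..v} (\<lambda>r. g r * q r powr - \<alpha>)"
          if "s \<le> u" "u \<le> v" "v \<le> t" for u v
          using that s t by (intro qi) auto
      qed (use s eq in auto)
      then show False using before[of s] s by auto
    qed
  qed (use 0 t in auto)
  then show ?thesis by simp
qed

lemma is_solution_increment:
  assumes x: "is_solution \<alpha> f g \<delta> x" and st: "0 < s" "s \<le> t" "ereal t < \<delta>"
  shows "x t - x s - (f t - f s) = ereal_integral {s..t} (\<lambda>r. I_fun \<alpha> g r (x r))" (is "?L = ?R")
proof -
  let ?I = "\<lambda>r. I_fun \<alpha> g r (x r)"
  have s': "ereal s < \<delta>" using st by (meson ereal_less_eq(3) le_less_trans)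
  have "t \<in> einterval 0 \<delta>" "s \<in> einterval 0 \<delta>"
    using st s' by (auto simp: einterval_def zero_ereal_def)
  then obtain lt ls where
    lt: "((\<lambda>\<epsilon>. ereal_integral {\<epsilon>..t} ?I) \<longlongrightarrow> lt) (at_right 0)" "x t = f t + lt" and
    ls: "((\<lambda>\<epsilon>. ereal_integral {\<epsilon>..s} ?I) \<longlongrightarrow> ls) (at_right 0)" "x s = f s + ls"
    using x unfolding is_solution_def by meson
  have "\<forall>\<^sub>F \<epsilon> in at_right 0. \<epsilon> \<in> {0<..<s}"
    using st(1) by (intro eventually_at_right_real)
  then have "\<forall>\<^sub>F \<epsilon> in at_right 0. ereal_integral {\<epsilon>..s} ?I + ?R = ereal_integral {\<epsilon>..t} ?I"
  proof eventually_elim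
    case (elim \<epsilon>)
    have ii: "(\<lambda>r. real_of_ereal (?I r)) absolutely_integrable_on {u..v}" if "0 < u" "v \<le> t" for u v
    proof -
      have "ereal r < \<delta>" if "r \<le> t" for r
        using that st(3) by (meson ereal_less_eq(3) le_less_trans)
      then have "{u..v} \<subseteq> einterval 0 \<delta>"
        using that by (auto simp: einterval_def zero_ereal_def)
      then show ?thesis
        using x unfolding is_solution_def ereal_integrable_on_def by blast
    qed
    have e: "ereal_integral {u..v} ?I = integral {u..v} (\<lambda>r. real_of_ereal (?I r))"
      if "0 < u" "v \<le> t" for u v
      unfolding ereal_integral_def by (rule set_lebesgue_integral_eq_integral(2)[OF ii[OF that]])
    have "(\<lambda>r. real_of_ereal (?I r)) integrable_on {\<epsilon>..t}"
      using ii[of \<epsilon> t] elim absolutely_integrable_on_def by auto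
    from Henstock_Kurzweil_Integration.integral_combine[OF _ _ this, of s] elim st
    show ?case by (simp add: e)
  qed
  then have "((\<lambda>\<epsilon>. ereal_integral {\<epsilon>..t} ?I) \<longlongrightarrow> ls + ?R) (at_right 0)"
    by (rule Lim_transform_eventually[rotated]) (intro tendsto_intros ls(1))
  then have "lt = ls + ?R"
    using tendsto_unique[OF _ lt(1)] by auto
  then show ?thesis using lt(2) ls(2) by simp
qed

text \<open>The improper integral defining a solution is \<open>x t - x \<epsilon> - (f t - f \<epsilon>)\<close> before the limit, and
  \<open>x\<close> and \<open>f\<close> are continuous at 0.\<close>
lemma is_solution_at_0:
  assumes f: "continuous_on {0..} f" and x: "is_solution \<alpha> f g \<delta> x" and \<delta>: "0 < \<delta>"
  shows "x 0 = f 0"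
proof -
  let ?I = "\<lambda>r. I_fun \<alpha> g r (x r)"
  obtain t where t: "0 < t" "ereal t < \<delta>"
    using ereal_dense2[OF \<delta>] by (auto simp: zero_ereal_def)
  have "t \<in> einterval 0 \<delta>" using t by (auto simp: einterval_def zero_ereal_def)
  then obtain l where l: "((\<lambda>\<epsilon>. ereal_integral {\<epsilon>..t} ?I) \<longlongrightarrow> l) (at_right 0)" "x t = f t + l"
    using x unfolding is_solution_def by meson
  have sub: "{0..t} \<subseteq> {t. 0 \<le> t \<and> ereal t < \<delta>}"
    using t(2) by (auto intro: le_less_trans[of _ "ereal t"])
  have "continuous_on {t. 0 \<le> t \<and> ereal t < \<delta>} x"
    using x unfolding is_solution_def by blast
  then have "continuous_on {0..t} x" by (rule continuous_on_subset[OF _ sub])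
  moreover have "continuous_on {0..t} f" by (rule continuous_on_subset[OF f]) auto
  ultimately have "continuous_on {0..t} (\<lambda>\<epsilon>. x t - x \<epsilon> - (f t - f \<epsilon>))"
    by (intro continuous_intros)
  from continuous_on_Icc_at_rightD[OF this t(1)]
  have "((\<lambda>\<epsilon>. x t - x \<epsilon> - (f t - f \<epsilon>)) \<longlongrightarrow> x t - x 0 - (f t - f 0)) (at_right 0)" .
  moreover have "\<forall>\<^sub>F \<epsilon> in at_right 0. \<epsilon> \<in> {0<..<t}"
    using t(1) by (intro eventually_at_right_real)
  then have "\<forall>\<^sub>F \<epsilon> in at_right 0. x t - x \<epsilon> - (f t - f \<epsilon>) = ereal_integral {\<epsilon>..t} ?I"
    by eventually_elim (use is_solution_increment[OF x] t in auto)
  ultimately have "((\<lambda>\<epsilon>. ereal_integral {\<epsilon>..t} ?I) \<longlongrightarrow> x t - x 0 - (f t - f 0)) (at_right 0)"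
    by (rule Lim_transform_eventually)
  then have "x t - x 0 - (f t - f 0) = l"
    using tendsto_unique[OF _ l(1)] by auto
  then show ?thesis using l(2) by simp
qed

lemma is_solution_less_pos_solution:
  assumes \<alpha>: "0 < \<alpha>" and g: "\<And>b. g absolutely_integrable_on {0..b}"
    and f: "continuous_on {0..} f" and x: "is_solution \<alpha> f g \<delta> x"
    and q: "pos_sol_on \<alpha> f g \<mu> t q" and \<mu>: "0 < \<mu>" and t: "0 \<le> t" "ereal t < \<delta>"
  shows "x t < q t"
proof (rule strict_comparison[where b=t and f=f and g=g and p=x and q=q, OF \<alpha> g])
  have lt: "ereal r < \<delta>" if "r \<le> t" for r
    using that t by (meson ereal_less_eq(3) le_less_trans)
  have "continuous_on {s. 0 \<le> s \<and> ereal s < \<delta>} x"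
    using x unfolding is_solution_def by blast
  then show "continuous_on {0..t} x"
    by (rule continuous_on_subset) (use lt in auto)
  show "continuous_on {0..t} q" "\<And>s. s \<in> {0..t} \<Longrightarrow> 0 < q s"
    using q by (auto simp: pos_sol_on_def)
  have "0 < \<delta>" using t by (metis ereal_less_eq(5) le_less_trans)
  then have "x 0 = f 0" by (rule is_solution_at_0[OF f x])
  moreover have "q 0 = \<mu> + f 0" using q t by (auto simp: pos_sol_on_def)
  ultimately show "x 0 < q 0" using \<mu> by simp
  show "t \<in> {0..t}" using t by auto
  show "q v - q u - (f v - f u) = integral {u..v} (\<lambda>r. g r * q r powr - \<alpha>)"
    if "0 < u" "u \<le> v" "v \<le> t" for u v
    using that pos_sol_on_increment[OF g q] by auto
  show "x v - x u - (f v - f u) = integral {u..v} (\<lambda>r. g r * x r powr - \<alpha>)"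
    if uv: "0 < u" "u \<le> v" "v \<le> t" and pos: "\<And>r. r \<in> {u..v} \<Longrightarrow> 0 < x r" for u v
  proof -
    have sub: "{u..v} \<subseteq> einterval 0 \<delta>"
      using uv lt by (auto simp: einterval_def zero_ereal_def)
    have "(\<lambda>r. real_of_ereal (I_fun \<alpha> g r (x r))) absolutely_integrable_on {u..v}"
      using x sub unfolding is_solution_def ereal_integrable_on_def by blast
    then have "ereal_integral {u..v} (\<lambda>r. I_fun \<alpha> g r (x r)) =
        integral {u..v} (\<lambda>r. real_of_ereal (I_fun \<alpha> g r (x r)))"
      unfolding ereal_integral_def by (rule set_lebesgue_integral_eq_integral(2))
    also have "\<dots> = integral {u..v} (\<lambda>r. g r * x r powr - \<alpha>)"
      using pos by (intro integral_cong) (simp add: I_fun_def powr_minus divide_inverse)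
    finally show ?thesis using is_solution_increment[OF x uv(1,2)] lt[OF uv(3)] by simp
  qed
qed

lemma pos_sol_on_strict_mono:
  assumes \<alpha>: "0 < \<alpha>" and g: "\<And>b. g absolutely_integrable_on {0..b}"
    and x: "pos_sol_on \<alpha> f g \<mu> t x" and y: "pos_sol_on \<alpha> f g \<nu> t y"
    and \<mu>: "\<mu> < \<nu>" and t: "0 \<le> t"
  shows "x t < y t"
proof (rule strict_comparison[where b=t and f=f and g=g and p=x and q=y, OF \<alpha> g])
  show "x 0 < y 0" using x y t \<mu> by (auto simp: pos_sol_on_def)
qed (use x y t pos_sol_on_increment[OF g x] pos_sol_on_increment[OF g y] in \<open>auto simp: pos_sol_on_def\<close>)

text \<open>Each \<open>b < T_max\<close> lies below the end of the interval of some solution; by uniqueness these solutions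
  agree where they overlap, so they glue along the diagonal \<open>t \<mapsto> X t t\<close>.\<close>
lemma x_mu_is_pos_solution:
  assumes \<alpha>: "0 < \<alpha>" and g: "\<And>b. g absolutely_integrable_on {0..b}"
  shows "is_pos_solution \<alpha> f g \<mu> (T_max \<alpha> f g \<mu>) (x_mu \<alpha> f g \<mu>)"
proof -
  define X where "X b = (SOME x. pos_sol_on \<alpha> f g \<mu> b x)" for b
  have X: "pos_sol_on \<alpha> f g \<mu> b (X b)" if b: "ereal b < T_max \<alpha> f g \<mu>" for b
  proof -
    obtain T x where "ereal b < T" "is_pos_solution \<alpha> f g \<mu> T x"
      using b[unfolded T_max_def less_Sup_iff] by blast
    then have "pos_sol_on \<alpha> f g \<mu> b x" by (intro pos_sol_on_restrict)
    then show ?thesis unfolding X_def by (rule someI[of "pos_sol_on \<alpha> f g \<mu> b"])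
  qed
  have "is_pos_solution \<alpha> f g \<mu> (T_max \<alpha> f g \<mu>) (\<lambda>t. X t t)"
  proof (rule is_pos_solutionI[OF g])
    fix b assume b: "0 \<le> b" "ereal b < T_max \<alpha> f g \<mu>"
    have eq: "X t t = X b t" if "t \<in> {0..b}" for t
    proof (rule pos_sol_on_unique[where x="X t" and y="X b" and b=t and t=t, OF \<alpha> g])
      have "ereal t < T_max \<alpha> f g \<mu>"
        using that b(2) by (auto intro: le_less_trans[of _ "ereal b"])
      then show "pos_sol_on \<alpha> f g \<mu> t (X t)" by (rule X)
      show "pos_sol_on \<alpha> f g \<mu> t (X b)"
        by (rule pos_sol_on_subinterval[OF X[OF b(2)]]) (use that in auto)
    qed (use that in auto)
    have "integral {0..t} (\<lambda>s. g s * X s s powr (- \<alpha>)) = integral {0..t} (\<lambda>s. g s * X b s powr (- \<alpha>))"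
      if "t \<in> {0..b}" for t
      by (rule integral_cong) (use that eq in auto)
    moreover have "continuous_on {0..b} (\<lambda>t. X t t) \<longleftrightarrow> continuous_on {0..b} (X b)"
      by (rule continuous_on_cong) (use eq in auto)
    moreover have "\<forall>t\<in>{0..b}. 0 < X t t"
      using X[OF b(2)] eq unfolding pos_sol_on_def by metis
    ultimately show "pos_sol_on \<alpha> f g \<mu> b (\<lambda>t. X t t)"
      using X[OF b(2)] eq unfolding pos_sol_on_def by simp
  qed
  then show ?thesis
    unfolding x_mu_def by (rule someI[of "is_pos_solution \<alpha> f g \<mu> (T_max \<alpha> f g \<mu>)"])
qed

lemma pos_sol_on_T_max:
  assumes "\<And>b. g absolutely_integrable_on {0..b}" "pos_sol_on \<alpha> f g \<mu> b x" "0 < b"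
  shows "ereal b \<le> T_max \<alpha> f g \<mu>"
  unfolding T_max_def
proof (rule Sup_upper, clarify, intro conjI exI)
  show "is_pos_solution \<alpha> f g \<mu> (ereal b) x"
    by (rule is_pos_solutionI[OF assms(1)]) (auto intro: pos_sol_on_subinterval[OF assms(2)])
qed (use assms in auto)

text \<open>Replacing \<open>y\<close> by \<open>max m y\<close> makes the nonlinearity globally Lipschitz. A solution of the truncated
  equation that stays above \<open>m\<close> solves the original one.\<close>
lemma truncated_equation_solution:
  fixes f g :: "real \<Rightarrow> real"
  assumes \<alpha>: "0 < \<alpha>" and g: "g absolutely_integrable_on {0..b}"
    and f: "continuous_on {0..} f" and b: "0 \<le> b" and m: "0 < m"
  obtains y where "continuous_on {0..b} y"
    "\<And>t. t \<in> {0..b} \<Longrightarrow> y t = \<mu> + f t + integral {0..t} (\<lambda>s. g s * max m (y s) powr (- \<alpha>))"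
proof -
  define C where "C = \<alpha> * m powr (-\<alpha>-1)"
  have lip: "\<bar>max m x powr (- \<alpha>) - max m y powr (- \<alpha>)\<bar> \<le> C * \<bar>x - y\<bar>" for x y
  proof -
    have "\<bar>max m x powr (- \<alpha>) - max m y powr (- \<alpha>)\<bar> \<le> C * \<bar>max m x - max m y\<bar>"
      unfolding C_def by (rule powr_neg_lipschitz) (use \<alpha> m in auto)
    also have "\<dots> \<le> C * \<bar>x - y\<bar>"
      using \<alpha> by (intro mult_left_mono) (auto simp: C_def)
    finally show ?thesis .
  qed
  have "continuous_on {0..b} (\<lambda>t. \<mu> + f t)"
    by (intro continuous_intros continuous_on_subset[OF f]) auto
  from integral_equation_existence[OF b g lip this] show ?thesis using that by blast
qed

text \<open>If \<open>\<mu> - 1\<close> is at least the total mass of \<open>|g|\<close> plus \<open>|min f|\<close>, the truncation at level 1 is never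
  active, since \<open>y powr (- \<alpha>) \<le> 1\<close> for \<open>y \<ge> 1\<close>. This shows that the set whose infimum is \<open>x_tilde\<close> is nonempty at every
  time; otherwise the infimum would be an unspecified real number.\<close>
lemma pos_sol_on_large_exists:
  assumes \<alpha>: "0 < \<alpha>" and g: "\<And>b. g absolutely_integrable_on {0..b}"
    and f: "continuous_on {0..} f" and b: "0 \<le> b"
  shows "\<exists>\<mu>>0. \<exists>y. pos_sol_on \<alpha> f g \<mu> b y"
proof -
  have ga: "(\<lambda>s. \<bar>g s\<bar>) integrable_on {0..c}" for c
    using abs_absolutely_integrable[OF g[of c]] absolutely_integrable_on_def by blast
  have fb: "continuous_on {0..b} f" using f by (rule continuous_on_subset) auto
  have "{0..b} \<noteq> {}" using b by auto
  then obtain t0 where t0: "\<And>t. t \<in> {0..b} \<Longrightarrow> f t0 \<le> f t"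
    using continuous_attains_inf[OF compact_Icc _ fb] by blast
  define \<mu> where "\<mu> = 1 + \<bar>f t0\<bar> + integral {0..b} (\<lambda>s. \<bar>g s\<bar>)"
  have "0 \<le> integral {0..b} (\<lambda>s. \<bar>g s\<bar>)" by (rule integral_nonneg[OF ga]) auto
  then have \<mu>: "0 < \<mu>" unfolding \<mu>_def by auto
  obtain y where y: "continuous_on {0..b} y"
    "\<And>t. t \<in> {0..b} \<Longrightarrow> y t = \<mu> + f t + integral {0..t} (\<lambda>s. g s * max 1 (y s) powr (- \<alpha>))"
    using truncated_equation_solution[OF \<alpha> g f b, of 1 \<mu>] by auto
  have y1: "1 \<le> y t" if t: "t \<in> {0..b}" for t
  proof -
    have yc: "continuous_on {0..t} (\<lambda>s. max 1 (y s))"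
      using t by (intro continuous_intros continuous_on_subset[OF y(1)]) auto
    have "(\<lambda>s. g s * max 1 (y s) powr (- \<alpha>)) integrable_on {0..t}"
      using absolutely_integrable_mult_powr[OF g yc] absolutely_integrable_on_def by fastforce
    then have "norm (integral {0..t} (\<lambda>s. g s * max 1 (y s) powr (- \<alpha>))) \<le> integral {0..t} (\<lambda>s. \<bar>g s\<bar>)"
    proof (rule Henstock_Kurzweil_Integration.integral_norm_bound_integral[OF _ ga])
      fix s
      have "max 1 (y s) powr (- \<alpha>) \<le> 1 powr (- \<alpha>)"
        using \<alpha> by (intro powr_mono2') auto
      then show "norm (g s * max 1 (y s) powr (- \<alpha>)) \<le> \<bar>g s\<bar>"
        by (simp add: abs_mult mult_left_le)
    qed
    also have "\<dots> \<le> integral {0..b} (\<lambda>s. \<bar>g s\<bar>)"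
      using t by (intro integral_subset_le ga) auto
    finally show ?thesis using y(2)[OF t] t0[OF t] unfolding \<mu>_def by auto
  qed
  have "integral {0..t} (\<lambda>s. g s * max 1 (y s) powr (- \<alpha>)) = integral {0..t} (\<lambda>s. g s * y s powr (- \<alpha>))"
    if "t \<in> {0..b}" for t
    using y1 that by (intro integral_cong) (auto simp: max_def)
  then have "pos_sol_on \<alpha> f g \<mu> b y"
    unfolding pos_sol_on_def using y y1 by force
  then show ?thesis using \<mu> by blast
qed

lemma is_solution_le_x_tilde:
  assumes \<alpha>: "0 < \<alpha>" and g: "\<And>b. g absolutely_integrable_on {0..b}"
    and f: "continuous_on {0..} f" and x: "is_solution \<alpha> f g \<delta> x"
    and t: "0 \<le> t" "ereal t < \<delta>"
  shows "x t \<le> x_tilde \<alpha> f g t"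
  unfolding x_tilde_def
proof (rule cInf_greatest)
  \<comment> \<open>A solution on \<open>{0..t + 1}\<close> ensures the strict inequality \<open>t < T_max\<close>.\<close>
  obtain \<mu> y where "0 < \<mu>" "pos_sol_on \<alpha> f g \<mu> (t + 1) y"
    using pos_sol_on_large_exists[OF \<alpha> g f, of "t + 1"] t by auto
  then have "0 < \<mu>" "ereal t < T_max \<alpha> f g \<mu>"
    using pos_sol_on_T_max[OF g, of \<alpha> f \<mu> "t + 1" y] t
    by (auto intro: less_le_trans[of _ "ereal (t + 1)"])
  then show "{x_mu \<alpha> f g \<mu> t |\<mu>. 0 < \<mu> \<and> ereal t < T_max \<alpha> f g \<mu>} \<noteq> {}" by blast
next
  fix z assume "z \<in> {x_mu \<alpha> f g \<mu> t |\<mu>. 0 < \<mu> \<and> ereal t < T_max \<alpha> f g \<mu>}"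
  then obtain \<mu> where \<mu>: "z = x_mu \<alpha> f g \<mu> t" "0 < \<mu>" "ereal t < T_max \<alpha> f g \<mu>" by auto
  have "pos_sol_on \<alpha> f g \<mu> t (x_mu \<alpha> f g \<mu>)"
    by (rule pos_sol_on_restrict[OF x_mu_is_pos_solution[OF \<alpha> g] \<mu>(3)])
  from is_solution_less_pos_solution[OF \<alpha> g f x this \<mu>(2) t]
  show "x t \<le> z" using \<mu>(1) by simp
qed

section \<open>The infimum of the perturbed solutions above a barrier\<close>

text \<open>The points \<open>0\<close> and \<open>t\<close> are left out of the comparison because powers with a negative exponent take
  a default value at 0 and a first-crossing argument gives no information at the crossing time.\<close>
lemma integral_mult_antimono:
  fixes g \<phi> \<psi> :: "real \<Rightarrow> real"
  assumes neg: "negligible {s\<in>{0..t}. 0 < g s}"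
    and i: "(\<lambda>s. g s * \<phi> s) integrable_on {0..t}" "(\<lambda>s. g s * \<psi> s) integrable_on {0..t}"
    and le: "\<And>s. 0 < s \<Longrightarrow> s < t \<Longrightarrow> \<phi> s \<le> \<psi> s"
  shows "integral {0..t} (\<lambda>s. g s * \<psi> s) \<le> integral {0..t} (\<lambda>s. g s * \<phi> s)"
proof -
  define N where "N = {s\<in>{0..t}. 0 < g s} \<union> {0, t}"
  have N: "negligible N" unfolding N_def by (intro negligible_Un neg) auto
  have "integral {0..t} (\<lambda>s. g s * \<psi> s) = integral {0..t} (\<lambda>s. if s \<in> N then 0 else g s * \<psi> s)"
    by (rule integral_spike[OF N]) auto
  also have "\<dots> \<le> integral {0..t} (\<lambda>s. if s \<in> N then 0 else g s * \<phi> s)"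
  proof (rule integral_le)
    show "(\<lambda>s. if s \<in> N then 0 else g s * \<psi> s) integrable_on {0..t}"
      by (rule integrable_spike[OF i(2) N]) auto
    show "(\<lambda>s. if s \<in> N then 0 else g s * \<phi> s) integrable_on {0..t}"
      by (rule integrable_spike[OF i(1) N]) auto
    show "(if s \<in> N then 0 else g s * \<psi> s) \<le> (if s \<in> N then 0 else g s * \<phi> s)"
      if "s \<in> {0..t}" for s
    proof (cases "s \<in> N")
      case False
      then have "g s \<le> 0" "0 < s" "s < t" using that by (auto simp: N_def)
      then have "g s * \<psi> s \<le> g s * \<phi> s" using le by (intro mult_left_mono_neg) auto
      then show ?thesis using False by simp
    qed simp
  qed
  also have "\<dots> = integral {0..t} (\<lambda>s. g s * \<phi> s)"
    by (rule integral_spike[OF N]) auto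
  finally show ?thesis .
qed

text \<open>Put \<open>z = f + \<integral> g v powr (- \<alpha>)\<close>; it is continuous and \<open>v \<le> z\<close>. As long as the truncated solution \<open>y\<close>
  lies above \<open>z\<close>, it lies above \<open>v\<close>, so its integrand exceeds that of \<open>z\<close> and \<open>y \<ge> \<mu> + z\<close>. Thus \<open>y\<close>
  never comes down to \<open>z\<close>, and it stays above the truncation level \<open>\<mu>\<close>. The comparison is made
  with \<open>z\<close> rather than \<open>v\<close> because a crossing argument needs a continuous function.\<close>
lemma pos_sol_on_above_barrier:
  fixes f g v :: "real \<Rightarrow> real"
  assumes \<alpha>: "0 < \<alpha>" and g: "\<And>b. g absolutely_integrable_on {0..b}"
    and f: "continuous_on {0..} f" and f0: "0 \<le> f 0" and b: "0 \<le> b"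
    and neg: "negligible {s\<in>{0..b}. 0 < g s}"
    and v: "\<And>t. 0 < t \<Longrightarrow> t \<le> b \<Longrightarrow> 0 < v t"
    and vi: "(\<lambda>s. g s * v s powr (- \<alpha>)) integrable_on {0..b}"
    and sub: "\<And>t. 0 < t \<Longrightarrow> t \<le> b \<Longrightarrow> v t \<le> f t + integral {0..t} (\<lambda>s. g s * v s powr (- \<alpha>))"
    and \<mu>: "0 < \<mu>"
  obtains y where "pos_sol_on \<alpha> f g \<mu> b y" "\<And>t. 0 < t \<Longrightarrow> t \<le> b \<Longrightarrow> v t \<le> y t"
proof -
  define z where "z t = f t + integral {0..t} (\<lambda>s. g s * v s powr (- \<alpha>))" for t
  have zc: "continuous_on {0..b} z"
    unfolding z_def
    by (intro continuous_on_add indefinite_integral_continuous_1[OF vi] continuous_on_subset[OF f]) auto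
  have z0: "0 \<le> z t" if "t \<in> {0..b}" for t
  proof (cases "t = 0")
    case True
    then show ?thesis using f0 by (simp add: z_def)
  next
    case False
    then show ?thesis using v[of t] sub[of t] that unfolding z_def by auto
  qed
  obtain y where y: "continuous_on {0..b} y"
    "\<And>t. t \<in> {0..b} \<Longrightarrow> y t = \<mu> + f t + integral {0..t} (\<lambda>s. g s * max \<mu> (y s) powr (- \<alpha>))"
    using truncated_equation_solution[OF \<alpha> g f b \<mu>, of \<mu>] by blast
  have key: "\<mu> + z t \<le> y t" if t: "0 \<le> t" "t \<le> b"
    and above: "\<And>s. 0 \<le> s \<Longrightarrow> s < t \<Longrightarrow> 0 < y s - z s" for t
  proof -
    have "negligible {s\<in>{0..t}. 0 < g s}"
      by (rule negligible_subset[OF neg]) (use t in auto)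
    moreover have "(\<lambda>s. g s * max \<mu> (y s) powr (- \<alpha>)) integrable_on {0..t}"
    proof -
      have "continuous_on {0..t} (\<lambda>s. max \<mu> (y s))"
        using t by (intro continuous_intros continuous_on_subset[OF y(1)]) auto
      moreover have "0 < max \<mu> (y s)" for s using \<mu> by auto
      ultimately show ?thesis
        using absolutely_integrable_mult_powr[OF g] absolutely_integrable_on_def by blast
    qed
    moreover have "(\<lambda>s. g s * v s powr (- \<alpha>)) integrable_on {0..t}"
      using t by (intro integrable_subinterval_real[OF vi]) auto
    moreover have "max \<mu> (y s) powr (- \<alpha>) \<le> v s powr (- \<alpha>)" if "0 < s" "s < t" for s
      using above[of s] sub[of s] v[of s] that t \<alpha> unfolding z_def
      by (intro powr_mono2') auto
    ultimately have "integral {0..t} (\<lambda>s. g s * v s powr (- \<alpha>))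
        \<le> integral {0..t} (\<lambda>s. g s * max \<mu> (y s) powr (- \<alpha>))"
      by (rule integral_mult_antimono)
    then show ?thesis using y(2)[of t] t by (simp add: z_def)
  qed
  have above: "0 < y t - z t" if "t \<in> {0..b}" for t
  proof (rule positive_by_first_zero[where d="\<lambda>t. y t - z t" and b=b])
    show "continuous_on {0..b} (\<lambda>t. y t - z t)" by (intro continuous_intros y zc)
    show "0 < y 0 - z 0" using key[of 0] b \<mu> by auto
    show "0 < y t - z t" if "0 < t" "t \<le> b" "\<And>s. 0 \<le> s \<Longrightarrow> s < t \<Longrightarrow> 0 < y s - z s" for t
      using key[of t] that \<mu> by auto
  qed (use that in auto)
  \<comment> \<open>The first-crossing step itself improves \<open>z < y\<close> to \<open>\<mu> + z \<le> y\<close>, which keeps \<open>y\<close> off the truncation.\<close>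
  have yz: "\<mu> + z t \<le> y t" if "t \<in> {0..b}" for t
    using that above by (intro key) auto
  have ymu: "\<mu> \<le> y t" if "t \<in> {0..b}" for t using yz[OF that] z0[OF that] by simp
  have "integral {0..t} (\<lambda>s. g s * max \<mu> (y s) powr (- \<alpha>)) = integral {0..t} (\<lambda>s. g s * y s powr (- \<alpha>))"
    if "t \<in> {0..b}" for t
    using ymu that by (intro integral_cong) (auto simp: max_def)
  then have "pos_sol_on \<alpha> f g \<mu> b y"
    unfolding pos_sol_on_def using y ymu \<mu> by force
  moreover have "v t \<le> y t" if "0 < t" "t \<le> b" for t
    using yz[of t] sub[of t] that \<mu> unfolding z_def by auto
  ultimately show ?thesis by (rule that)
qed

lemma is_solutionI_positive:
  fixes f g x :: "real \<Rightarrow> real"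
  assumes g: "\<And>b. g absolutely_integrable_on {0..b}"
    and f: "continuous_on {0..} f"
    and x0: "0 \<le> f 0" and pos: "\<And>t. 0 < t \<Longrightarrow> t < \<delta> \<Longrightarrow> 0 < x t"
    and i: "\<And>t. 0 \<le> t \<Longrightarrow> t < \<delta> \<Longrightarrow> (\<lambda>s. g s * x s powr (- \<alpha>)) integrable_on {0..t}"
    and eq: "\<And>t. 0 \<le> t \<Longrightarrow> t < \<delta> \<Longrightarrow> x t = f t + integral {0..t} (\<lambda>s. g s * x s powr (- \<alpha>))"
  shows "is_solution \<alpha> f g (ereal \<delta>) x"
proof -
  let ?I = "\<lambda>r. I_fun \<alpha> g r (x r)"
  have cont: "continuous_on {0..b} x" if "b < \<delta>" for b
  proof (cases "0 \<le> b")
    case True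
    have "continuous_on {0..b} (\<lambda>t. f t + integral {0..t} (\<lambda>s. g s * x s powr (- \<alpha>)))"
      using True that
      by (intro continuous_on_add indefinite_integral_continuous_1 i continuous_on_subset[OF f]) auto
    moreover have "continuous_on {0..b} x \<longleftrightarrow>
        continuous_on {0..b} (\<lambda>t. f t + integral {0..t} (\<lambda>s. g s * x s powr (- \<alpha>)))"
      by (rule continuous_on_cong) (use eq that in auto)
    ultimately show ?thesis by simp
  qed simp
  have I: "real_of_ereal (?I s) = g s * x s powr (- \<alpha>)" "\<bar>?I s\<bar> \<noteq> \<infinity>" if "0 < s" "s < \<delta>" for s
    using pos[OF that] by (simp_all add: I_fun_def powr_minus divide_inverse)
  have si: "(\<lambda>s. real_of_ereal (?I s)) absolutely_integrable_on {a..b}" if ab: "0 < a" "b < \<delta>" for a b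
  proof -
    have "g absolutely_integrable_on {a..b}"
      using ab by (intro absolutely_integrable_on_subinterval[OF g[of b]]) auto
    moreover have "continuous_on {a..b} x"
      using ab by (intro continuous_on_subset[OF cont[of b]]) auto
    moreover have "0 < x s" if "s \<in> {a..b}" for s using that ab pos by auto
    ultimately have "(\<lambda>s. g s * x s powr (- \<alpha>)) absolutely_integrable_on {a..b}"
      by (rule absolutely_integrable_mult_powr)
    then show ?thesis
      by (rule absolutely_integrable_spike[OF _ negligible_empty]) (use ab I in auto)
  qed
  show ?thesis
    unfolding is_solution_def
  proof (intro conjI allI impI ballI)
    show "continuous_on {t. 0 \<le> t \<and> ereal t < ereal \<delta>} x"
      using cont by (intro continuous_on_half_openI) auto
    show "0 \<le> x t" if "0 \<le> t \<and> ereal t < ereal \<delta>" for t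
      using that pos[of t] eq[of t] x0 by (cases "t = 0") auto
    show "ereal_integrable_on (\<lambda>s. I_fun \<alpha> g s (x s)) K"
      if K: "compact K \<and> K \<subseteq> einterval 0 (ereal \<delta>)" for K
    proof (cases "K = {}")
      case False
      obtain a where a: "a \<in> K" "\<And>s. s \<in> K \<Longrightarrow> a \<le> s"
        using compact_attains_inf[of K] K False by blast
      obtain b where b: "b \<in> K" "\<And>s. s \<in> K \<Longrightarrow> s \<le> b"
        using compact_attains_sup[of K] K False by blast
      have ab: "0 < a" "b < \<delta>" using K a b by (auto simp: einterval_def zero_ereal_def)
      have "set_integrable lebesgue K (\<lambda>s. real_of_ereal (?I s))"
      proof (rule set_integrable_subset[OF si[OF ab]])
        show "K \<in> sets lebesgue" using K lmeasurable_compact fmeasurableD by blast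
        show "K \<subseteq> {a..b}" using a b by auto
      qed
      moreover have "\<bar>?I s\<bar> \<noteq> \<infinity>" if "s \<in> K" for s
        using I(2)[of s] a(2)[OF that] b(2)[OF that] ab by auto
      ultimately show ?thesis unfolding ereal_integrable_on_def by auto
    qed (simp add: ereal_integrable_on_def)
    fix t assume "t \<in> einterval 0 (ereal \<delta>)"
    then have t: "0 < t" "t < \<delta>" by (auto simp: einterval_def zero_ereal_def)
    let ?w = "\<lambda>\<epsilon>. integral {0..\<epsilon>} (\<lambda>s. g s * x s powr (- \<alpha>))"
    have "((\<lambda>\<epsilon>. ?w t - ?w \<epsilon>) \<longlongrightarrow> ?w t - ?w 0) (at_right 0)"
    proof (rule continuous_on_Icc_at_rightD[OF _ t(1)])
      show "continuous_on {0..t} (\<lambda>\<epsilon>. ?w t - ?w \<epsilon>)"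
        using t by (intro continuous_on_diff continuous_on_const indefinite_integral_continuous_1 i) auto
    qed
    moreover have "\<forall>\<^sub>F \<epsilon> in at_right 0. \<epsilon> \<in> {0<..<t}"
      using t(1) by (intro eventually_at_right_real)
    then have "\<forall>\<^sub>F \<epsilon> in at_right 0. ?w t - ?w \<epsilon> = ereal_integral {\<epsilon>..t} ?I"
    proof eventually_elim
      case (elim \<epsilon>)
      have "?w t - ?w \<epsilon> = integral {\<epsilon>..t} (\<lambda>s. g s * x s powr (- \<alpha>))"
        using elim t by (intro integral_diff_eq_integral i) auto
      also have "\<dots> = integral {\<epsilon>..t} (\<lambda>s. real_of_ereal (?I s))"
        using elim t I by (intro integral_cong) auto
      also have "\<dots> = ereal_integral {\<epsilon>..t} ?I"
        unfolding ereal_integral_def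
        using elim t by (intro set_lebesgue_integral_eq_integral(2)[symmetric] si) auto
      finally show ?case .
    qed
    ultimately have "((\<lambda>\<epsilon>. ereal_integral {\<epsilon>..t} ?I) \<longlongrightarrow> ?w t - ?w 0) (at_right 0)"
      by (rule Lim_transform_eventually)
    then show "\<exists>l. ((\<lambda>\<epsilon>. ereal_integral {\<epsilon>..t} ?I) \<longlongrightarrow> l) (at_right 0) \<and> x t = f t + l"
      using eq[of t] t by (intro exI[of _ "?w t"]) auto
  qed
qed

text \<open>By comparison the perturbed solutions decrease with \<open>\<mu>\<close>, so along \<open>\<mu> = 1 / (n + 1)\<close> they converge to
  their infimum over all \<open>\<mu>\<close>. The barrier bounds them from below and thereby provides the dominating
  function that carries the integral equation to the limit.\<close>
lemma x_tilde_above_barrier: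
  fixes f g v :: "real \<Rightarrow> real"
  assumes \<alpha>: "0 < \<alpha>" and g: "\<And>b. g absolutely_integrable_on {0..b}"
    and f: "continuous_on {0..} f" and f0: "0 \<le> f 0" and \<delta>: "0 < \<delta>"
    and neg: "negligible {s\<in>{0..\<delta>}. 0 < g s}"
    and v: "\<And>t. 0 < t \<Longrightarrow> t \<le> \<delta> \<Longrightarrow> 0 < v t"
    and vi: "(\<lambda>s. g s * v s powr (- \<alpha>)) absolutely_integrable_on {0..\<delta>}"
    and sub: "\<And>t. 0 < t \<Longrightarrow> t \<le> \<delta> \<Longrightarrow> v t \<le> f t + integral {0..t} (\<lambda>s. g s * v s powr (- \<alpha>))"
  shows "is_solution \<alpha> f g (ereal \<delta>) (x_tilde \<alpha> f g)" (is ?sol)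
    and "\<And>t. 0 < t \<Longrightarrow> t < \<delta> \<Longrightarrow> x_tilde \<alpha> f g t \<le> f t"
    and "\<And>t. 0 < t \<Longrightarrow> t < \<delta> \<Longrightarrow>
           f t + integral {0..t} (\<lambda>s. g s * v s powr (- \<alpha>)) \<le> x_tilde \<alpha> f g t"
proof -
  define X where "X = x_mu \<alpha> f g"
  define x where "x = x_tilde \<alpha> f g"
  have vi': "(\<lambda>s. g s * v s powr (- \<alpha>)) integrable_on {0..t}" if "t \<le> \<delta>" for t
    by (rule integrable_subinterval_real[OF set_lebesgue_integral_eq_integral(1)[OF vi]]) (use that in auto)
  have Tm: "ereal \<delta> \<le> T_max \<alpha> f g \<mu>" and Xy: "\<And>t. 0 < t \<Longrightarrow> t < \<delta> \<Longrightarrow> v t \<le> X \<mu> t"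
    and Xs: "\<And>t. t < \<delta> \<Longrightarrow> pos_sol_on \<alpha> f g \<mu> t (X \<mu>)" if \<mu>: "0 < \<mu>" for \<mu>
  proof -
    obtain y where y: "pos_sol_on \<alpha> f g \<mu> \<delta> y" "\<And>t. 0 < t \<Longrightarrow> t \<le> \<delta> \<Longrightarrow> v t \<le> y t"
      using pos_sol_on_above_barrier[OF \<alpha> g f f0 less_imp_le[OF \<delta>] neg v vi'[OF order_refl] sub \<mu>]
      by blast
    show T: "ereal \<delta> \<le> T_max \<alpha> f g \<mu>" by (rule pos_sol_on_T_max[OF g y(1) \<delta>])
    show X: "pos_sol_on \<alpha> f g \<mu> t (X \<mu>)" if "t < \<delta>" for t
      unfolding X_def
      by (rule pos_sol_on_restrict[OF x_mu_is_pos_solution[OF \<alpha> g]])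
         (use that T in \<open>auto intro: less_le_trans[of _ "ereal \<delta>"]\<close>)
    show "v t \<le> X \<mu> t" if "0 < t" "t < \<delta>" for t
    proof -
      have "X \<mu> t = y t"
        by (rule pos_sol_on_unique[OF \<alpha> g X[OF that(2)] pos_sol_on_subinterval[OF y(1)]])
           (use that in auto)
      then show ?thesis using y(2) that by auto
    qed
  qed
  have x_alt: "x t = Inf {X \<mu> t |\<mu>. 0 < \<mu>}" if "t < \<delta>" for t
  proof -
    have "ereal t < T_max \<alpha> f g \<mu>" if "0 < \<mu>" for \<mu>
      using Tm[OF that] \<open>t < \<delta>\<close> by (auto intro: less_le_trans[of _ "ereal \<delta>"])
    then have "{x_mu \<alpha> f g \<mu> t |\<mu>. 0 < \<mu> \<and> ereal t < T_max \<alpha> f g \<mu>} = {x_mu \<alpha> f g \<mu> t |\<mu>. 0 < \<mu>}"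
      by blast
    then show ?thesis unfolding x_def x_tilde_def X_def by simp
  qed
  have bdd: "bdd_below {X \<mu> t |\<mu>. 0 < \<mu>}" if "0 \<le> t" "t < \<delta>" for t
  proof (rule bdd_belowI[of _ 0])
    fix z assume "z \<in> {X \<mu> t |\<mu>. 0 < \<mu>}"
    then obtain \<mu> where \<mu>: "z = X \<mu> t" "0 < \<mu>" by blast
    then have "pos_sol_on \<alpha> f g \<mu> t (X \<mu>)" using Xs that by blast
    then have "0 < X \<mu> t" using that unfolding pos_sol_on_def by (meson atLeastAtMost_iff order_refl)
    then show "0 \<le> z" using \<mu>(1) by simp
  qed
  have lower: "x t \<le> X \<mu> t" if "0 < \<mu>" "0 \<le> t" "t < \<delta>" for \<mu> t
    unfolding x_alt[OF that(3)] by (rule cInf_lower[OF _ bdd]) (use that in auto)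
  have xv: "v t \<le> x t" if "0 < t" "t < \<delta>" for t
    unfolding x_alt[OF that(2)]
    by (rule cInf_greatest) (use Xy that in \<open>auto intro: exI[of _ 1]\<close>)
  define m where "m n = 1 / real (Suc n)" for n
  have m: "0 < m n" for n by (simp add: m_def)
  have m0: "m \<longlonglongrightarrow> 0" unfolding m_def by (rule LIMSEQ_Suc[OF lim_1_over_n])
  have lim: "(\<lambda>n. X (m n) t) \<longlonglongrightarrow> x t" if t: "0 \<le> t" "t < \<delta>" for t
  proof (rule order_tendstoI)
    fix a assume "a < x t"
    then show "\<forall>\<^sub>F n in sequentially. a < X (m n) t"
      using lower[OF m t] by (auto intro!: always_eventually less_le_trans[of a "x t"])
  next
    fix a assume "x t < a"
    then have "Inf {X \<mu> t |\<mu>. 0 < \<mu>} < a" unfolding x_alt[OF t(2)] .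
    moreover have "X 1 t \<in> {X \<mu> t |\<mu>. 0 < \<mu>}" by force
    ultimately obtain \<mu> where \<mu>: "0 < \<mu>" "X \<mu> t < a"
      using cInf_lessD[of "{X \<mu> t |\<mu>. 0 < \<mu>}" a] by blast
    have "\<forall>\<^sub>F n in sequentially. m n < \<mu>" by (rule order_tendstoD(2)[OF m0 \<mu>(1)])
    then show "\<forall>\<^sub>F n in sequentially. X (m n) t < a"
    proof eventually_elim
      case (elim n)
      have "X (m n) t < X \<mu> t"
        by (rule pos_sol_on_strict_mono[OF \<alpha> g Xs[OF m t(2)] Xs[OF \<mu>(1) t(2)] elim t(1)])
      then show ?case using \<mu>(2) by simp
    qed
  qed
  have main: "(\<lambda>s. g s * x s powr (- \<alpha>)) integrable_on {0..t} \<and>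
      x t = f t + integral {0..t} (\<lambda>s. g s * x s powr (- \<alpha>))" if t: "0 \<le> t" "t < \<delta>" for t
  proof -
    let ?F = "\<lambda>n s. g s * X (m n) s powr (- \<alpha>)"
    have Xsol: "continuous_on {0..t} (X (m n))" "\<And>s. s \<in> {0..t} \<Longrightarrow> 0 < X (m n) s"
      "X (m n) t = m n + f t + integral {0..t} (?F n)" for n
      using Xs[OF m[of n] t(2)] t unfolding pos_sol_on_def by auto
    \<comment> \<open>On the open interval, because at 0 the limit may vanish and the power is then discontinuous.\<close>
    have Fi: "?F n integrable_on {0<..<t}" for n
        unfolding integrable_on_open_interval_real
        by (rule set_lebesgue_integral_eq_integral(1)[OF absolutely_integrable_mult_powr[OF g Xsol(1,2)]])
    have hi: "(\<lambda>s. \<bar>g s * v s powr (- \<alpha>)\<bar>) integrable_on {0<..<t}"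
        unfolding integrable_on_open_interval_real
        using t by (intro set_lebesgue_integral_eq_integral(1) abs_absolutely_integrable
            absolutely_integrable_on_subinterval[OF vi]) auto
    have Fh: "norm (?F n s) \<le> \<bar>g s * v s powr (- \<alpha>)\<bar>" if s: "s \<in> {0<..<t}" for n s
      proof -
        have "X (m n) s powr (- \<alpha>) \<le> v s powr (- \<alpha>)"
          using Xy[OF m] v[of s] s t \<alpha> by (intro powr_mono2') auto
        then show ?thesis by (simp add: abs_mult mult_left_mono)
      qed
    have Fx: "(\<lambda>n. ?F n s) \<longlonglongrightarrow> g s * x s powr (- \<alpha>)" if s: "s \<in> {0<..<t}" for s
      proof -
        have "x s \<noteq> 0" using xv[of s] v[of s] s t by auto
        then show ?thesis using s t by (intro tendsto_intros lim) auto
      qed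
    note dc = dominated_convergence[OF Fi hi Fh Fx]
    have "(\<lambda>n. m n + f t + integral {0..t} (?F n)) \<longlonglongrightarrow>
        0 + f t + integral {0..t} (\<lambda>s. g s * x s powr (- \<alpha>))"
      unfolding integral_open_interval_real by (intro tendsto_intros m0 dc(2))
    moreover have "(\<lambda>n. m n + f t + integral {0..t} (?F n)) \<longlonglongrightarrow> x t"
      using lim[OF t] unfolding Xsol(3) .
    ultimately have "x t = 0 + f t + integral {0..t} (\<lambda>s. g s * x s powr (- \<alpha>))"
      by (rule LIMSEQ_unique[rotated])
    then show ?thesis using dc(1) unfolding integrable_on_open_interval_real by simp
  qed
  have xpos: "0 < x t" if "0 < t" "t < \<delta>" for t using xv[of t] v[of t] that by simp
  show ?sol
    using main xpos unfolding x_def[symmetric]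
    by (intro is_solutionI_positive[OF g f f0]) auto
  fix t assume t: "0 < t" "t < \<delta>"
  have ng: "negligible {s\<in>{0..t}. 0 < g s}"
    by (rule negligible_subset[OF neg]) (use t in auto)
  have xi: "(\<lambda>s. g s * x s powr (- \<alpha>)) integrable_on {0..t}"
    and xe: "x t = f t + integral {0..t} (\<lambda>s. g s * x s powr (- \<alpha>))"
    using main[of t] t by auto
  have "integral {0..t} (\<lambda>s. g s * x s powr (- \<alpha>)) \<le> integral {0..t} (\<lambda>s. g s * 0)"
    by (rule integral_mult_antimono[OF ng _ xi]) auto
  then show "x_tilde \<alpha> f g t \<le> f t" using xe by (simp add: x_def)
  have "integral {0..t} (\<lambda>s. g s * v s powr (- \<alpha>)) \<le> integral {0..t} (\<lambda>s. g s * x s powr (- \<alpha>))"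
  proof (rule integral_mult_antimono[OF ng xi vi'])
    show "x s powr (- \<alpha>) \<le> v s powr (- \<alpha>)" if "0 < s" "s < t" for s
      using xv[of s] v[of s] that t \<alpha> by (intro powr_mono2') auto
  qed (use t in auto)
  then show "f t + integral {0..t} (\<lambda>s. g s * v s powr (- \<alpha>)) \<le> x_tilde \<alpha> f g t"
    using xe by (simp add: x_def)
qed

section \<open>The chain rule for an absolutely continuous inner function\<close>

text \<open>The error of the identity is additive over adjacent intervals. On a short interval around \<open>x\<close> both
  sides are within \<open>e (A t - A s) / 2\<close> of \<open>\<psi> (A x) (A t - A s)\<close>, by the mean value theorem and by
  continuity of \<open>\<psi> \<circ> A\<close>. Hence the total error is at most \<open>e (A b - A a)\<close> for every \<open>e > 0\<close>. The
  argument suits a merely integrable \<open>p\<close>, for which \<open>A' = p\<close> holds only almost everywhere.\<close>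
lemma integral_chain_rule:
  fixes p A \<Phi> \<psi> :: "real \<Rightarrow> real"
  assumes ab: "a \<le> b" and p: "p absolutely_integrable_on {a..b}" and nn: "\<And>s. 0 \<le> p s"
    and A: "continuous_on {a..b} A"
    and Ai: "\<And>s t. a \<le> s \<Longrightarrow> s \<le> t \<Longrightarrow> t \<le> b \<Longrightarrow> A t - A s = integral {s..t} p"
    and \<Phi>: "\<And>y. y \<in> {A a..A b} \<Longrightarrow> (\<Phi> has_real_derivative \<psi> y) (at y)"
    and \<psi>: "continuous_on {A a..A b} \<psi>"
  shows "(\<lambda>s. p s * \<psi> (A s)) absolutely_integrable_on {a..b}"
    and "integral {a..b} (\<lambda>s. p s * \<psi> (A s)) = \<Phi> (A b) - \<Phi> (A a)"
proof -
  have mono: "A s \<le> A t" if "a \<le> s" "s \<le> t" "t \<le> b" for s t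
  proof -
    have "0 \<le> integral {s..t} p"
      using that nn
      by (intro integral_nonneg set_lebesgue_integral_eq_integral(1) absolutely_integrable_on_subinterval[OF p]) auto
    then show ?thesis using Ai[OF that] by simp
  qed
  have \<psi>A: "continuous_on {a..b} (\<lambda>s. \<psi> (A s))"
    by (rule continuous_on_compose2[OF \<psi> A]) (use mono in auto)
  show i: "(\<lambda>s. p s * \<psi> (A s)) absolutely_integrable_on {a..b}"
    by (rule absolutely_integrable_mult_continuous[OF p \<psi>A])
  have bound: "\<bar>\<Phi> (A b) - \<Phi> (A a) - integral {a..b} (\<lambda>s. p s * \<psi> (A s))\<bar> \<le> e * (A b - A a)"
    if e: "0 < e" for e
  proof -
    define P where "P s t \<longleftrightarrow> (a \<le> s \<longrightarrow> s \<le> t \<longrightarrow> t \<le> b \<longrightarrow>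
        \<bar>\<Phi> (A t) - \<Phi> (A s) - integral {s..t} (\<lambda>s. p s * \<psi> (A s))\<bar> \<le> e * (A t - A s))" for s t
    from ab have "P a b"
    proof (induction rule: Bolzano)
      case (trans u v w)
      show ?case
        unfolding P_def
      proof (intro impI)
        assume *: "a \<le> u" "u \<le> w" "w \<le> b"
        have 1: "\<bar>\<Phi> (A v) - \<Phi> (A u) - integral {u..v} (\<lambda>s. p s * \<psi> (A s))\<bar> \<le> e * (A v - A u)"
          using trans(1,3,4) * unfolding P_def by simp
        have 2: "\<bar>\<Phi> (A w) - \<Phi> (A v) - integral {v..w} (\<lambda>s. p s * \<psi> (A s))\<bar> \<le> e * (A w - A v)"
          using trans(2,3,4) * unfolding P_def by simp
        have 3: "integral {u..v} (\<lambda>s. p s * \<psi> (A s)) + integral {v..w} (\<lambda>s. p s * \<psi> (A s))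
            = integral {u..w} (\<lambda>s. p s * \<psi> (A s))"
          using trans(3,4) *
          by (intro Henstock_Kurzweil_Integration.integral_combine set_lebesgue_integral_eq_integral(1)
              absolutely_integrable_on_subinterval[OF i]) auto
        have 4: "e * (A w - A u) = e * (A v - A u) + e * (A w - A v)" by (simp add: algebra_simps)
        show "\<bar>\<Phi> (A w) - \<Phi> (A u) - integral {u..w} (\<lambda>s. p s * \<psi> (A s))\<bar> \<le> e * (A w - A u)"
          unfolding 3[symmetric] 4 using 1 2 by linarith
      qed
    next
      case (local x)
      have "0 < e / 2" using e by simp
      then obtain d where d: "0 < d"
        "\<And>r. r \<in> {a..b} \<Longrightarrow> dist r x < d \<Longrightarrow> dist (\<psi> (A r)) (\<psi> (A x)) < e / 2"
        using \<psi>A local unfolding continuous_on_iff by (meson atLeastAtMost_iff)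
      show ?case
      proof (intro exI[of _ d] conjI allI impI d(1))
        fix s t assume st: "s \<le> x \<and> x \<le> t \<and> t - s < d"
        show "P s t"
          unfolding P_def
        proof (intro impI)
          assume *: "a \<le> s" "s \<le> t" "t \<le> b"
          define c where "c = \<psi> (A x)"
          have near: "\<bar>\<psi> (A r) - c\<bar> \<le> e / 2" if "r \<in> {s..t}" for r
          proof -
            have "dist (\<psi> (A r)) (\<psi> (A x)) < e / 2"
              using that st * by (intro d(2)) (auto simp: dist_real_def)
            then show ?thesis unfolding c_def dist_real_def by simp
          qed
          have pst: "p absolutely_integrable_on {s..t}"
            using * by (intro absolutely_integrable_on_subinterval[OF p]) auto
          have pi: "p integrable_on {s..t}" by (rule set_lebesgue_integral_eq_integral(1)[OF pst])
          have ist: "(\<lambda>s. p s * \<psi> (A s)) integrable_on {s..t}"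
            using *
            by (intro set_lebesgue_integral_eq_integral(1) absolutely_integrable_on_subinterval[OF i]) auto
          have sub: "{A s..A t} \<subseteq> {A a..A b}"
            using mono[of a s] mono[of t b] * by auto
          have "norm ((\<Phi> (A t) - c * A t) - (\<Phi> (A s) - c * A s)) \<le> e / 2 * norm (A t - A s)"
          proof (rule field_differentiable_bound[where S="{A s..A t}" and f="\<lambda>y. \<Phi> y - c * y"
                  and f'="\<lambda>y. \<psi> y - c"])
            show "convex {A s..A t}" by (rule convex_real_interval)
            show "((\<lambda>y. \<Phi> y - c * y) has_field_derivative \<psi> y - c) (at y within {A s..A t})"
              if "y \<in> {A s..A t}" for y
              by (rule has_field_derivative_at_within)
                 (use \<Phi>[of y] that sub in \<open>auto intro!: derivative_eq_intros\<close>)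
            show "norm (\<psi> y - c) \<le> e / 2" if y: "y \<in> {A s..A t}" for y
            proof -
              have "continuous_on {s..t} A" using * by (intro continuous_on_subset[OF A]) auto
              \<comment> \<open>Every value between \<open>A s\<close> and \<open>A t\<close> is attained in \<open>{s..t}\<close>, where \<open>\<psi> \<circ> A\<close> is close to \<open>c\<close>.\<close>
              then obtain r where "s \<le> r" "r \<le> t" "A r = y"
                using IVT'[of A s y t] y *(2) by auto
              then show ?thesis using near[of r] by auto
            qed
          qed (use mono[of s t] * in auto)
          then have 1: "\<bar>(\<Phi> (A t) - c * A t) - (\<Phi> (A s) - c * A s)\<bar> \<le> e / 2 * (A t - A s)"
            using mono[of s t] * by simp
          have "norm (integral {s..t} (\<lambda>r. p r * \<psi> (A r) - p r * c)) \<le> integral {s..t} (\<lambda>r. p r * (e / 2))"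
          proof (rule Henstock_Kurzweil_Integration.integral_norm_bound_integral)
            show "norm (p r * \<psi> (A r) - p r * c) \<le> p r * (e / 2)" if "r \<in> {s..t}" for r
              using near[OF that] nn[of r]
              by (simp add: right_diff_distrib[symmetric] abs_mult mult_left_mono del: times_divide_eq_right)
          qed (intro integrable_diff integrable_on_mult_left ist pi)+
          also have "integral {s..t} (\<lambda>r. p r * (e / 2)) = integral {s..t} p * (e / 2)"
            by (rule integral_mult_left)
          also have "integral {s..t} (\<lambda>r. p r * \<psi> (A r) - p r * c) =
              integral {s..t} (\<lambda>r. p r * \<psi> (A r)) - integral {s..t} (\<lambda>r. p r * c)"
            by (rule integral_diff) (intro integrable_on_mult_left ist pi)+
          also have "integral {s..t} (\<lambda>r. p r * c) = integral {s..t} p * c"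
            by (rule integral_mult_left)
          finally have 2: "\<bar>integral {s..t} (\<lambda>r. p r * \<psi> (A r)) - (A t - A s) * c\<bar> \<le> e / 2 * (A t - A s)"
            using Ai[OF *] by (simp add: mult.commute)
          have 3: "(A t - A s) * c = c * A t - c * A s" by (simp add: algebra_simps)
          have 4: "e * (A t - A s) = e / 2 * (A t - A s) + e / 2 * (A t - A s)"
            by (simp add: algebra_simps)
          show "\<bar>\<Phi> (A t) - \<Phi> (A s) - integral {s..t} (\<lambda>s. p s * \<psi> (A s))\<bar> \<le> e * (A t - A s)"
            using 1 2 unfolding 3 4 by linarith
        qed
      qed
    qed
    then show ?thesis using ab unfolding P_def by simp
  qed
  have "\<bar>\<Phi> (A b) - \<Phi> (A a) - integral {a..b} (\<lambda>s. p s * \<psi> (A s))\<bar> \<le> 0"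
  proof (rule field_le_epsilon)
    fix e :: real assume e: "0 < e"
    have "0 \<le> A b - A a" using mono[of a b] ab by simp
    \<comment> \<open>The summand 1 covers the case \<open>A b = A a\<close>.\<close>
    then have "e / (A b - A a + 1) * (A b - A a) \<le> e"
      using e by (simp add: field_simps)
    then show "\<bar>\<Phi> (A b) - \<Phi> (A a) - integral {a..b} (\<lambda>s. p s * \<psi> (A s))\<bar> \<le> 0 + e"
      using bound[of "e / (A b - A a + 1)"] e \<open>0 \<le> A b - A a\<close> by auto
  qed
  then show "integral {a..b} (\<lambda>s. p s * \<psi> (A s)) = \<Phi> (A b) - \<Phi> (A a)" by simp
qed

text \<open>Here \<open>\<psi>\<close> may blow up at 0, and monotone convergence over \<open>{\<epsilon> n..b}\<close> gives the integral up to 0. The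
  condition \<open>\<psi> 0 = 0\<close> fixes the value at the left end point, so that the convergence holds at every
  point.\<close>
lemma has_integral_chain_rule_from_0:
  fixes p A \<Phi> \<psi> :: "real \<Rightarrow> real"
  assumes b: "0 < b" and p: "p absolutely_integrable_on {0..b}" and nn: "\<And>s. 0 \<le> p s"
    and A: "\<And>t. A t = integral {0..t} p"
    and pos: "\<And>t. 0 < t \<Longrightarrow> t \<le> b \<Longrightarrow> 0 < A t"
    and \<Phi>: "\<And>y. 0 < y \<Longrightarrow> y \<le> A b \<Longrightarrow> (\<Phi> has_real_derivative \<psi> y) (at y)"
    and \<psi>: "continuous_on {0<..A b} \<psi>" "\<And>y. 0 < y \<Longrightarrow> y \<le> A b \<Longrightarrow> 0 \<le> \<psi> y" "\<psi> 0 = 0"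
    and \<Phi>0: "(\<Phi> \<longlongrightarrow> 0) (at_right 0)"
  shows "((\<lambda>s. p s * \<psi> (A s)) has_integral \<Phi> (A b)) {0..b}"
proof -
  have pi: "p integrable_on {0..b}" by (rule set_lebesgue_integral_eq_integral(1)[OF p])
  have Ac: "continuous_on {0..b} A"
    unfolding A by (rule indefinite_integral_continuous_1[OF pi])
  have Ai: "A t - A s = integral {s..t} p" if "0 \<le> s" "s \<le> t" "t \<le> b" for s t
    unfolding A using that
    by (intro integral_diff_eq_integral integrable_subinterval_real[OF pi]) auto
  have Amono: "A s \<le> A b" if "0 \<le> s" "s \<le> b" for s
  proof -
    have "0 \<le> integral {s..b} p"
      using that nn by (intro integral_nonneg integrable_subinterval_real[OF pi]) auto
    then show ?thesis using Ai[of s b] that by simp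
  qed
  define \<epsilon> where "\<epsilon> n = b / real (n + 2)" for n
  have \<epsilon>: "0 < \<epsilon> n" "\<epsilon> n \<le> b" for n using b by (auto simp: \<epsilon>_def field_simps)
  have \<epsilon>mono: "\<epsilon> (Suc n) \<le> \<epsilon> n" for n using b by (auto simp: \<epsilon>_def field_simps)
  have \<epsilon>0: "\<epsilon> \<longlonglongrightarrow> 0" unfolding \<epsilon>_def using b by real_asymp
  define F where "F n s = (if s \<in> {\<epsilon> n..b} then p s * \<psi> (A s) else 0)" for n s
  show ?thesis
  proof (rule has_integral_monotone_convergence_increasing[where f=F and x="\<lambda>n. \<Phi> (A b) - \<Phi> (A (\<epsilon> n))"])
    fix n
    have sub: "{\<epsilon> n..b} \<subseteq> {0..b}" using \<epsilon>[of n] by auto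
    have sub': "{A (\<epsilon> n)..A b} \<subseteq> {0<..A b}" using pos[OF \<epsilon>[of n]] by auto
    have Ai': "A t - A s = integral {s..t} p" if "\<epsilon> n \<le> s" "s \<le> t" "t \<le> b" for s t
      using that \<epsilon>(1)[of n] by (intro Ai) auto
    have \<Phi>': "(\<Phi> has_real_derivative \<psi> y) (at y)" if "y \<in> {A (\<epsilon> n)..A b}" for y
      using that sub' by (intro \<Phi>) auto
    note cr = integral_chain_rule[OF \<epsilon>(2)[of n] absolutely_integrable_on_subinterval[OF p sub] nn
        continuous_on_subset[OF Ac sub] Ai' \<Phi>' continuous_on_subset[OF \<psi>(1) sub']]
    have "((\<lambda>s. p s * \<psi> (A s)) has_integral (\<Phi> (A b) - \<Phi> (A (\<epsilon> n)))) {\<epsilon> n..b}"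
      using set_lebesgue_integral_eq_integral(1)[OF cr(1)] cr(2)
      by (simp add: has_integral_integrable_integral)
    then show "(F n has_integral (\<Phi> (A b) - \<Phi> (A (\<epsilon> n)))) {0..b}"
      unfolding F_def by (rule has_integral_restrict[OF sub, THEN iffD2])
  next
    fix n s assume s: "s \<in> {0..b}"
    have "0 \<le> p s * \<psi> (A s)" if "0 < s"
      using nn \<psi>(2) pos[of s] Amono[of s] s that by (intro mult_nonneg_nonneg) auto
    then show "F n s \<le> F (Suc n) s"
      unfolding F_def using \<epsilon>mono[of n] \<epsilon>[of "Suc n"] by auto
  next
    fix s assume s: "s \<in> {0..b}"
    show "(\<lambda>n. F n s) \<longlonglongrightarrow> p s * \<psi> (A s)"
    proof (cases "s = 0")
      case True
      have "A 0 = 0" by (simp add: A)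
      then have "F n s = p s * \<psi> (A s)" for n
        using True \<psi>(3) \<epsilon>[of n] by (simp add: F_def)
      then show ?thesis by simp
    next
      case False
      then have "\<forall>\<^sub>F n in sequentially. \<epsilon> n < s"
        using s by (intro order_tendstoD(2)[OF \<epsilon>0]) auto
      then have "\<forall>\<^sub>F n in sequentially. F n s = p s * \<psi> (A s)"
        by eventually_elim (use s in \<open>auto simp: F_def\<close>)
      then show ?thesis by (rule tendsto_eventually)
    qed
  next
    have "filterlim (\<lambda>n. A (\<epsilon> n)) (at_right 0) sequentially"
      unfolding filterlim_at
    proof
      show "\<forall>\<^sub>F n in sequentially. A (\<epsilon> n) \<in> {0<..} \<and> A (\<epsilon> n) \<noteq> 0"
        using pos[OF \<epsilon>] by (intro always_eventually) (metis greaterThan_iff less_irrefl)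
      have "(\<lambda>n. A (\<epsilon> n)) \<longlonglongrightarrow> A 0"
        by (rule continuous_on_tendsto_compose[OF Ac \<epsilon>0])
           (use b \<epsilon> in \<open>auto intro!: always_eventually less_imp_le\<close>)
      then show "(\<lambda>n. A (\<epsilon> n)) \<longlonglongrightarrow> 0" by (simp add: A)
    qed
    then have "(\<lambda>n. \<Phi> (A (\<epsilon> n))) \<longlonglongrightarrow> 0" by (rule filterlim_compose[OF \<Phi>0])
    then have "(\<lambda>n. \<Phi> (A b) - \<Phi> (A (\<epsilon> n))) \<longlonglongrightarrow> \<Phi> (A b) - 0"
      by (intro tendsto_intros)
    then show "(\<lambda>n. \<Phi> (A b) - \<Phi> (A (\<epsilon> n))) \<longlonglongrightarrow> \<Phi> (A b)" by simp
  qed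
qed

section \<open>The barrier and its logarithmic inequality\<close>

text \<open>In terms of \<open>l = - ln u\<close>. The difference of the two sides is \<open>L\<^sup>2 (J\<^sup>3 - J\<^sup>4 / 2) + O(L\<^sup>3)\<close>.\<close>
lemma eventually_log_inequality:
  "\<forall>\<^sub>F l in at_top. let L = 1 / l; J = 1 / ln l; P = L * (1 + J + J\<^sup>2);
       S = P + L\<^sup>2 * (1 + J + 2 * J\<^sup>2 + 2 * J ^ 3)
     in P + L\<^sup>2 * (1 + J\<^sup>2) / 2 \<le> S - S\<^sup>2 / (2::real)"
  unfolding Let_def by real_asymp

text \<open>Taylor's formula at 0; the third derivative is negative.\<close>
lemma powr_neg_le_quadratic:
  fixes p z :: real
  assumes "0 < p" "0 \<le> z"
  shows "(1 + z) powr (- p) \<le> 1 - p * z + p * (p + 1) / 2 * z\<^sup>2"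
proof -
  define h where "h z = 1 - p * z + p * (p + 1) / 2 * z\<^sup>2 - (1 + z) powr (- p)" for z
  define h' where "h' z = - p + p * (p + 1) * z + p * (1 + z) powr (- p - 1)" for z
  have d1: "(h has_real_derivative h' z) (at z)" if "0 \<le> z" for z
    unfolding h_def h'_def using that by (auto intro!: derivative_eq_intros simp: field_simps)
  have d2: "(h' has_real_derivative p * (p + 1) * (1 - (1 + z) powr (- p - 2))) (at z)" if "0 \<le> z" for z
    unfolding h'_def using that by (auto intro!: derivative_eq_intros simp: algebra_simps)
  have h'nn: "0 \<le> h' z" if z: "0 \<le> z" for z
  proof -
    have "h' 0 \<le> h' z"
    proof (rule DERIV_nonneg_imp_nondecreasing[OF z])
      fix x assume "0 \<le> x" "x \<le> z"
      moreover have "(1 + x) powr (- p - 2) \<le> 1"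
        using \<open>0 \<le> x\<close> assms powr_mono2'[of "- p - 2" 1 "1 + x"] by simp
      then have "0 \<le> p * (p + 1) * (1 - (1 + x) powr (- p - 2))" using assms by auto
      ultimately show "\<exists>y. (h' has_real_derivative y) (at x) \<and> 0 \<le> y" using d2 by blast
    qed
    then show ?thesis by (simp add: h'_def)
  qed
  have "h 0 \<le> h z"
    by (rule DERIV_nonneg_imp_nondecreasing[OF assms(2)]) (use d1 h'nn in blast)
  then show ?thesis by (simp add: h_def)
qed

text \<open>\<open>L\<close> and \<open>J\<close> of the statement as functions of \<open>u = G(t)\<close>. Below, \<open>u * log_P u\<close> is the logarithmic
  correction in the bound to be proved, and \<open>log_S\<close> is its derivative. The latter formula comes from
  \<open>u dL/du = L\<^sup>2\<close> and \<open>u dJ/du = J\<^sup>2 L\<close>.\<close>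
definition log_L :: "real \<Rightarrow> real" where "log_L u = 1 / \<bar>ln u\<bar>"

definition log_J :: "real \<Rightarrow> real" where "log_J u = 1 / \<bar>ln (log_L u)\<bar>"

definition log_P :: "real \<Rightarrow> real" where
  "log_P u = log_L u * (1 + log_J u + (log_J u)\<^sup>2)"

definition log_S :: "real \<Rightarrow> real" where
  "log_S u = log_P u + (log_L u)\<^sup>2 * (1 + log_J u + 2 * (log_J u)\<^sup>2 + 2 * log_J u ^ 3)"

text \<open>The bound on \<open>f - x_tilde\<close> in terms of \<open>u = G(t)\<close>, its derivative, and the function \<open>b(u)\<close> solving
  \<open>b(u) powr (- \<alpha>) = deficit' \<alpha> u * u powr (- \<alpha>)\<close>, which is what \<open>\<integral> |g| b(G) powr (- \<alpha>) = deficit \<alpha> (G)\<close>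
  requires.\<close>
definition deficit :: "real \<Rightarrow> real \<Rightarrow> real" where
  "deficit \<alpha> u = \<alpha> powr (- (\<alpha> / (\<alpha> + 1))) * (u + \<alpha> / (\<alpha> + 1) * (u * log_P u))"

definition deficit' :: "real \<Rightarrow> real \<Rightarrow> real" where
  "deficit' \<alpha> u = \<alpha> powr (- (\<alpha> / (\<alpha> + 1))) * (1 + \<alpha> / (\<alpha> + 1) * log_S u)"

definition barrier :: "real \<Rightarrow> real \<Rightarrow> real" where
  "barrier \<alpha> u = u * deficit' \<alpha> u powr (- (1 / \<alpha>))"

lemma log_LJ_eq:
  assumes "0 < u" "u < exp (- 1)"
  shows "1 < - ln u" "log_L u = 1 / (- ln u)" "log_J u = 1 / ln (- ln u)"
proof -
  have "ln u < -1" using assms by (metis ln_exp ln_less_cancel_iff exp_gt_zero)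
  then show 1: "1 < - ln u" by simp
  show 2: "log_L u = 1 / (- ln u)" using 1 by (simp add: log_L_def)
  have "ln (1 / (- ln u)) = - ln (- ln u)" using 1 by (subst ln_div) auto
  moreover have "0 < ln (- ln u)" using 1 by (rule ln_gt_zero)
  ultimately show "log_J u = 1 / ln (- ln u)" unfolding log_J_def 2 by simp
qed

lemma log_nonneg: "0 \<le> log_L u" "0 \<le> log_J u" "0 \<le> log_S u"
  by (auto simp: log_L_def log_J_def log_P_def log_S_def)

lemma deficit'_pos: "0 < \<alpha> \<Longrightarrow> 0 < deficit' \<alpha> u"
  unfolding deficit'_def using log_nonneg(3)[of u] by (intro mult_pos_pos add_pos_nonneg) auto

lemma deficit_has_derivative:
  assumes u: "0 < u" "u < exp (- 1)"
  shows "(deficit \<alpha> has_real_derivative deficit' \<alpha> u) (at u)"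
proof -
  let ?a = "\<alpha> powr (- (\<alpha> / (\<alpha> + 1)))" and ?b = "\<alpha> / (\<alpha> + 1)"
  define l where "l = - ln u"
  have l: "1 < l" "0 < ln l" using log_LJ_eq(1)[OF u] by (auto simp: l_def)
  define P where "P u = 1 / (- ln u) * (1 + 1 / ln (- ln u) + (1 / ln (- ln u))\<^sup>2)" for u :: real
  have P: "(P has_real_derivative ((1/l)\<^sup>2 * (1 + 1/ln l + 2*(1/ln l)\<^sup>2 + 2*(1/ln l)^3)) / u) (at u)"
  proof -
    define q where "q l = 1 / l * (1 + 1 / ln l + (1 / ln l)\<^sup>2)" for l :: real
    have "(q has_real_derivative - ((1/l)\<^sup>2 * (1 + 1/ln l + 2*(1/ln l)\<^sup>2 + 2*(1/ln l)^3))) (at l)"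
      unfolding q_def using l
      by (auto intro!: derivative_eq_intros simp: field_simps power2_eq_square power3_eq_cube)
    moreover have "((\<lambda>u. - ln u) has_real_derivative - (1 / u)) (at u)"
      using u by (auto intro!: derivative_eq_intros)
    ultimately have "((\<lambda>u. q (- ln u)) has_real_derivative
        - ((1/l)\<^sup>2 * (1 + 1/ln l + 2*(1/ln l)\<^sup>2 + 2*(1/ln l)^3)) * - (1 / u)) (at u)"
      unfolding l_def by (rule DERIV_chain2)
    then show ?thesis unfolding P_def q_def by simp
  qed
  have eq: "log_P y = P y" if "y \<in> {0<..<exp (-1)}" for y
    unfolding log_P_def P_def using that log_LJ_eq[of y] by simp
  have d: "((\<lambda>u. ?a * (u + ?b * (u * P u))) has_real_derivative deficit' \<alpha> u) (at u)"
  proof -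
    have "((\<lambda>u. ?a * (u + ?b * (u * P u))) has_real_derivative
        ?a * (1 + ?b * (1 * P u + ((1/l)\<^sup>2 * (1 + 1/ln l + 2*(1/ln l)\<^sup>2 + 2*(1/ln l)^3)) / u * u))) (at u)"
      by (intro DERIV_cmult DERIV_add DERIV_mult DERIV_ident P)
    moreover have "log_S u = 1 * P u + ((1/l)\<^sup>2 * (1 + 1/ln l + 2*(1/ln l)\<^sup>2 + 2*(1/ln l)^3)) / u * u"
      using u eq[of u] log_LJ_eq[OF u] unfolding log_S_def l_def by simp
    ultimately show ?thesis unfolding deficit'_def by simp
  qed
  show ?thesis
    by (rule has_field_derivative_transform_within_open[OF d, where S="{0<..<exp (-1)}"])
       (use u eq in \<open>auto simp: deficit_def\<close>)
qed

lemma deficit_tendsto_0: "(deficit \<alpha> \<longlongrightarrow> 0) (at_right 0)"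
proof -
  have "((\<lambda>u::real. u * (1 / (- ln u) * (1 + 1 / ln (- ln u) + (1 / ln (- ln u))\<^sup>2))) \<longlongrightarrow> 0) (at_right 0)"
    by real_asymp
  moreover have "\<forall>\<^sub>F u in at_right 0. u \<in> {0<..<exp (-1)::real}"
    by (intro eventually_at_right_real) simp
  then have "\<forall>\<^sub>F u in at_right 0. u * (1 / (- ln u) * (1 + 1 / ln (- ln u) + (1 / ln (- ln u))\<^sup>2)) = u * log_P u"
    by eventually_elim (use log_LJ_eq in \<open>auto simp: log_P_def\<close>)
  ultimately have "((\<lambda>u. u * log_P u) \<longlongrightarrow> 0) (at_right 0)"
    by (rule Lim_transform_eventually)
  then have "((\<lambda>u. \<alpha> powr (- (\<alpha> / (\<alpha> + 1))) * (u + \<alpha> / (\<alpha> + 1) * (u * log_P u))) \<longlongrightarrow>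
      \<alpha> powr (- (\<alpha> / (\<alpha> + 1))) * (0 + \<alpha> / (\<alpha> + 1) * 0)) (at_right 0)"
    by (intro tendsto_intros)
  then show ?thesis unfolding deficit_def[abs_def] by simp
qed

lemma deficit'_continuous: "continuous_on {0<..<exp (- 1)} (deficit' \<alpha>)"
proof -
  have L: "continuous_on {0<..<exp (- 1)} log_L"
  proof -
    have "continuous_on {0<..<exp (- 1)} (\<lambda>u::real. 1 / (- ln u))"
      by (intro continuous_intros) (use log_LJ_eq(1) in force)+
    then show ?thesis by (rule continuous_on_eq) (use log_LJ_eq(2) in auto)
  qed
  have J: "continuous_on {0<..<exp (- 1)} log_J"
  proof -
    have "continuous_on {0<..<exp (- 1)} (\<lambda>u::real. 1 / ln (- ln u))"
    proof (intro continuous_intros ballI)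
      fix u :: real assume "u \<in> {0<..<exp (- 1)}"
      then have "1 < - ln u" using log_LJ_eq(1) by auto
      then show "u \<noteq> 0" "- ln u \<noteq> 0" "ln (- ln u) \<noteq> 0"
        using ln_gt_zero[of "- ln u"] by auto
    qed
    then show ?thesis by (rule continuous_on_eq) (use log_LJ_eq(3) in auto)
  qed
  show ?thesis
    unfolding deficit'_def[abs_def] log_S_def[abs_def] log_P_def[abs_def]
    by (intro continuous_intros L J)
qed

text \<open>With \<open>a = \<alpha> powr (- \<alpha> / (\<alpha> + 1))\<close> one has \<open>k0 \<alpha> = (\<alpha> + 1) a\<close>, \<open>K0 \<alpha> = \<alpha> a / (2 (\<alpha> + 1))\<close> and
  \<open>a powr (- 1 / \<alpha>) = \<alpha> a\<close>. Bounding \<open>(1 + \<alpha> S / (\<alpha> + 1)) powr (- 1 / \<alpha>)\<close> by its quadratic Taylor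
  polynomial \<open>1 - (S - S\<^sup>2 / 2) / (\<alpha> + 1)\<close> and dividing by \<open>\<alpha> a u / (\<alpha> + 1)\<close> leaves exactly the
  inequality of \<open>eventually_log_inequality\<close>.\<close>
lemma barrier_inequality:
  assumes \<alpha>: "0 < \<alpha>"
  obtains u0 where "0 < u0" "u0 \<le> exp (- 1)"
    "\<And>u. 0 < u \<Longrightarrow> u < u0 \<Longrightarrow> barrier \<alpha> u + deficit \<alpha> u \<le>
        k0 \<alpha> * u - K0 \<alpha> * u * (log_L u)\<^sup>2 * (1 + (log_J u)\<^sup>2)"
proof -
  have "filterlim (\<lambda>u::real. - ln u) at_top (at_right 0)" by real_asymp
  from filterlim_iff[THEN iffD1, OF this, rule_format, OF eventually_log_inequality]
  obtain u1 where u1: "0 < u1" and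
    ineq: "\<And>u. 0 < u \<Longrightarrow> u < u1 \<Longrightarrow> (let L = 1 / (- ln u); J = 1 / ln (- ln u); P = L * (1 + J + J\<^sup>2);
       S = P + L\<^sup>2 * (1 + J + 2 * J\<^sup>2 + 2 * J ^ 3)
     in P + L\<^sup>2 * (1 + J\<^sup>2) / 2 \<le> S - S\<^sup>2 / (2::real))"
    unfolding eventually_at_right_field by blast
  show ?thesis
  proof (rule that[of "min u1 (exp (- 1))"])
    fix u assume u: "0 < u" "u < min u1 (exp (- 1))"
    define L J P S where "L = log_L u" and "J = log_J u" and "P = log_P u" and "S = log_S u"
    note LJ = log_LJ_eq[OF u(1)]
    have key: "P + L\<^sup>2 * (1 + J\<^sup>2) / 2 \<le> S - S\<^sup>2 / 2"
      using ineq[of u] u LJ unfolding L_def J_def P_def S_def log_P_def log_S_def Let_def by simp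
    define a where "a = \<alpha> powr (- (\<alpha> / (\<alpha> + 1)))"
    have a: "0 < a" unfolding a_def using \<alpha> by simp
    have a2: "\<alpha> powr (1 / (\<alpha> + 1)) = \<alpha> * a"
    proof -
      have "1 / (\<alpha> + 1) = 1 + (- (\<alpha> / (\<alpha> + 1)))" using \<alpha> by (simp add: field_simps)
      then have "\<alpha> powr (1 / (\<alpha> + 1)) = \<alpha> powr (1 + (- (\<alpha> / (\<alpha> + 1))))" by (rule arg_cong)
      also have "\<dots> = \<alpha> * a"
        unfolding a_def using \<alpha> by (subst powr_add) simp
      finally show ?thesis .
    qed
    have a1: "a powr (- (1 / \<alpha>)) = \<alpha> * a"
    proof -
      have "- (\<alpha> / (\<alpha> + 1)) * - (1 / \<alpha>) = 1 / (\<alpha> + 1)" using \<alpha> by simp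
      then show ?thesis unfolding a2[symmetric] unfolding a_def powr_powr by simp
    qed
    have S0: "0 \<le> S" unfolding S_def by (rule log_nonneg)
    have "deficit' \<alpha> u powr (- (1 / \<alpha>)) = \<alpha> * a * (1 + \<alpha> / (\<alpha> + 1) * S) powr (- (1 / \<alpha>))"
      unfolding deficit'_def a_def[symmetric] S_def[symmetric] using a \<alpha> S0
      by (subst powr_mult) (auto simp: a1)
    also have "\<dots> \<le> \<alpha> * a * (1 - 1 / \<alpha> * (\<alpha> / (\<alpha> + 1) * S)
        + 1 / \<alpha> * (1 / \<alpha> + 1) / 2 * (\<alpha> / (\<alpha> + 1) * S)\<^sup>2)"
      using \<alpha> a S0 by (intro mult_left_mono powr_neg_le_quadratic) auto
    also have "\<dots> = \<alpha> * a * (1 - (S - S\<^sup>2 / 2) / (\<alpha> + 1))"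
    proof -
      have "1 / \<alpha> * (\<alpha> / (\<alpha> + 1) * S) = S / (\<alpha> + 1)" using \<alpha> by simp
      moreover have "1 / \<alpha> * (1 / \<alpha> + 1) / 2 * (\<alpha> / (\<alpha> + 1) * S)\<^sup>2 = S\<^sup>2 / 2 / (\<alpha> + 1)"
        using \<alpha> by (simp add: divide_simps power2_eq_square) (simp add: algebra_simps)
      ultimately show ?thesis by (simp add: diff_divide_distrib)
    qed
    also have "\<dots> \<le> \<alpha> * a * (1 - (P + L\<^sup>2 * (1 + J\<^sup>2) / 2) / (\<alpha> + 1))"
      using \<alpha> a key by (intro mult_left_mono diff_left_mono divide_right_mono) auto
    finally have "barrier \<alpha> u \<le> u * (\<alpha> * a * (1 - (P + L\<^sup>2 * (1 + J\<^sup>2) / 2) / (\<alpha> + 1)))"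
      unfolding barrier_def using u by (intro mult_left_mono) auto
    also have "\<dots> = k0 \<alpha> * u - K0 \<alpha> * u * L\<^sup>2 * (1 + J\<^sup>2) - deficit \<alpha> u"
      unfolding k0_def K0_def deficit_def a2 a_def[symmetric] P_def[symmetric]
      using \<alpha> by (simp add: divide_simps) (simp add: algebra_simps)
    finally show "barrier \<alpha> u + deficit \<alpha> u \<le> k0 \<alpha> * u - K0 \<alpha> * u * (log_L u)\<^sup>2 * (1 + (log_J u)\<^sup>2)"
      unfolding L_def J_def by simp
  qed (use u1 in auto)
qed

text \<open>\<open>G\<close> as a function of the mass \<open>y = \<integral>\<^sub>0\<^sup>t |g|\<close>.\<close>
definition G_of_mass :: "real \<Rightarrow> real \<Rightarrow> real" where
  "G_of_mass \<alpha> y = ((\<alpha> + 1) * y) powr (1 / (\<alpha> + 1))"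

lemma G_of_mass_has_derivative:
  assumes "0 < \<alpha>" "0 < y"
  shows "(G_of_mass \<alpha> has_real_derivative G_of_mass \<alpha> y powr (- \<alpha>)) (at y)"
proof -
  have "((\<lambda>y. ((\<alpha> + 1) * y) powr (1 / (\<alpha> + 1))) has_real_derivative
      1 / (\<alpha> + 1) * ((\<alpha> + 1) * y) powr (1 / (\<alpha> + 1) - 1) * (\<alpha> + 1)) (at y)"
    by (rule DERIV_chain2[where f="\<lambda>z. z powr (1 / (\<alpha> + 1))"])
       (use assms in \<open>auto intro!: has_real_derivative_powr derivative_eq_intros\<close>)
  moreover have "1 / (\<alpha> + 1) - 1 = 1 / (\<alpha> + 1) * (- \<alpha>)"
    using assms by (simp add: field_simps)
  ultimately show ?thesis
    using assms unfolding G_of_mass_def[abs_def] powr_powr by simp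
qed

lemma barrier_powr:
  assumes "0 < \<alpha>" "0 \<le> u"
  shows "barrier \<alpha> u powr (- \<alpha>) = deficit' \<alpha> u * u powr (- \<alpha>)"
proof -
  have "(deficit' \<alpha> u powr (- (1 / \<alpha>))) powr (- \<alpha>) = deficit' \<alpha> u"
    using assms deficit'_pos[of \<alpha> u] by (simp add: powr_powr)
  then show ?thesis
    unfolding barrier_def using assms by (subst powr_mult) auto
qed

lemma barrier_has_integral:
  fixes g :: "real \<Rightarrow> real"
  assumes \<alpha>: "0 < \<alpha>" and t: "0 < t" and g: "g absolutely_integrable_on {0..t}"
    and G: "\<And>s. G s = G_of_mass \<alpha> (integral {0..s} (\<lambda>r. \<bar>g r\<bar>))"
    and pos: "\<And>s. 0 < s \<Longrightarrow> s \<le> t \<Longrightarrow> 0 < integral {0..s} (\<lambda>r. \<bar>g r\<bar>)"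
    and small: "G t < exp (- 1)"
  shows "((\<lambda>s. \<bar>g s\<bar> * barrier \<alpha> (G s) powr (- \<alpha>)) has_integral deficit \<alpha> (G t)) {0..t}"
proof -
  define A where "A s = integral {0..s} (\<lambda>r. \<bar>g r\<bar>)" for s
  define \<psi> where "\<psi> y = deficit' \<alpha> (G_of_mass \<alpha> y) * G_of_mass \<alpha> y powr (- \<alpha>)" for y
  have range: "G_of_mass \<alpha> y \<in> {0<..<exp (- 1)}" if "0 < y" "y \<le> A t" for y
  proof -
    have "G_of_mass \<alpha> y \<le> G_of_mass \<alpha> (A t)"
      unfolding G_of_mass_def using that \<alpha> by (intro powr_mono2) auto
    then show ?thesis using small that \<alpha> unfolding G A_def[symmetric]
      by (auto simp: G_of_mass_def)
  qed
  have Gc: "continuous_on {0<..A t} (G_of_mass \<alpha>)"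
    using G_of_mass_has_derivative[OF \<alpha>]
    by (intro continuous_at_imp_continuous_on ballI) (auto intro: DERIV_isCont)
  have "((\<lambda>s. \<bar>g s\<bar> * \<psi> (A s)) has_integral deficit \<alpha> (G_of_mass \<alpha> (A t))) {0..t}"
  proof (rule has_integral_chain_rule_from_0[where \<Phi>="\<lambda>y. deficit \<alpha> (G_of_mass \<alpha> y)"])
    show "(\<lambda>s. \<bar>g s\<bar>) absolutely_integrable_on {0..t}" by (rule abs_absolutely_integrable[OF g])
    show "0 < A s" if "0 < s" "s \<le> t" for s using pos that by (simp add: A_def)
    show "((\<lambda>y. deficit \<alpha> (G_of_mass \<alpha> y)) has_real_derivative \<psi> y) (at y)" if y: "0 < y" "y \<le> A t" for y
      unfolding \<psi>_def
      by (rule DERIV_chain2[OF deficit_has_derivative G_of_mass_has_derivative]) (use \<alpha> y range[OF y] in auto)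
    have "continuous_on {0<..A t} (\<lambda>y. deficit' \<alpha> (G_of_mass \<alpha> y))"
      by (rule continuous_on_compose2[OF deficit'_continuous Gc]) (use range in auto)
    moreover have "continuous_on {0<..A t} (\<lambda>y. G_of_mass \<alpha> y powr (- \<alpha>))"
      by (intro continuous_on_powr Gc continuous_on_const) (use range in force)
    ultimately show "continuous_on {0<..A t} \<psi>"
      unfolding \<psi>_def[abs_def] by (rule continuous_on_mult)
    show "0 \<le> \<psi> y" for y
      unfolding \<psi>_def using deficit'_pos[OF \<alpha>] by (intro mult_nonneg_nonneg) (auto intro: less_imp_le)
    show "\<psi> 0 = 0" by (simp add: \<psi>_def G_of_mass_def)
    have "filterlim (G_of_mass \<alpha>) (at_right 0) (at_right 0)"
      unfolding G_of_mass_def[abs_def] using \<alpha> by real_asymp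
    then show "((\<lambda>y. deficit \<alpha> (G_of_mass \<alpha> y)) \<longlongrightarrow> 0) (at_right 0)"
      by (rule filterlim_compose[OF deficit_tendsto_0])
  qed (auto simp: A_def t)
  moreover have "\<psi> (A s) = barrier \<alpha> (G s) powr (- \<alpha>)" for s
    unfolding \<psi>_def G A_def[symmetric] using \<alpha> by (subst barrier_powr) (auto simp: G_of_mass_def)
  ultimately show ?thesis unfolding G A_def[symmetric] by simp
qed

section \<open>The maximal solution and its lower bound\<close>

theorem theorem2p7:
  fixes \<alpha> :: real and f g :: "real \<Rightarrow> real" and \<tau> :: ereal
  assumes "\<alpha> > 0"
    and "continuous_on {0..} f"
    and "f 0 \<ge> 0"
    and "\<And>T. T > 0 \<Longrightarrow> set_integrable lebesgue {0<..<T} g"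
    and "\<tau> > 0"
    and "esssup (restrict_space lebesgue (einterval 0 \<tau>)) (\<lambda>t. ereal (g t)) \<le> 0"
    and "\<And>t. t \<in> einterval 0 \<tau> \<Longrightarrow> G_fun \<alpha> g t > 0"
    and "\<And>t. t \<in> einterval 0 \<tau> \<Longrightarrow> LJ_defined \<alpha> g t \<Longrightarrow>
           f t \<ge> k0 \<alpha> * G_fun \<alpha> g t
                  - K0 \<alpha> * G_fun \<alpha> g t * (L_fun \<alpha> g t)\<^sup>2 * (1 + (J_fun \<alpha> g t)\<^sup>2)"
  shows "\<exists>\<delta>::real. \<delta> > 0 \<and> ereal \<delta> \<le> \<tau> \<and>
           is_solution \<alpha> f g (ereal \<delta>) (x_tilde \<alpha> f g) \<and>
           (\<forall>\<delta>' x. is_solution \<alpha> f g \<delta>' x \<longrightarrow>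
              (\<forall>t. 0 \<le> t \<and> ereal t < \<delta>' \<longrightarrow> x t \<le> x_tilde \<alpha> f g t)) \<and>
           (\<forall>t\<in>{0<..<\<delta>}.
              0 \<ge> x_tilde \<alpha> f g t - f t \<and>
              (LJ_defined \<alpha> g t \<longrightarrow>
                x_tilde \<alpha> f g t - f t \<ge>
                  - (\<alpha> powr (- (\<alpha> / (\<alpha> + 1)))) *
                    (G_fun \<alpha> g t + \<alpha> / (\<alpha> + 1) * G_fun \<alpha> g t * L_fun \<alpha> g t *
                       (1 + J_fun \<alpha> g t + (J_fun \<alpha> g t)\<^sup>2))))"
proof -
  note \<alpha> = assms(1) and f = assms(2) and f0 = assms(3)
  have g: "g absolutely_integrable_on {0..b}" for b
  proof -
    have "g absolutely_integrable_on {0<..<max b 0 + 1}" by (rule assms(4)) simp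
    then have "g absolutely_integrable_on {0<..b}"
      by (rule set_integrable_subset) auto
    then show ?thesis
      by (rule absolutely_integrable_spike_set)
         (auto intro: negligible_subset[of "{0}"])
  qed
  define A where "A t = integral {0..t} (\<lambda>r. \<bar>g r\<bar>)" for t
  define G where "G t = G_of_mass \<alpha> (A t)" for t
  have ga: "(\<lambda>r. \<bar>g r\<bar>) integrable_on {0..b}" for b
    by (rule set_lebesgue_integral_eq_integral(1)[OF abs_absolutely_integrable[OF g]])
  have AE: "AE x in lebesgue. x \<in> einterval 0 \<tau> \<longrightarrow> g x \<le> 0"
  proof -
    have "AE x in restrict_space lebesgue (einterval 0 \<tau>). ereal (g x) \<le> 0"
      using esssup_AE[of "\<lambda>t. ereal (g t)" "restrict_space lebesgue (einterval 0 \<tau>)"]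
      by eventually_elim (rule order_trans[OF _ assms(6)])
    then show ?thesis by (subst (asm) AE_restrict_space_iff) auto
  qed
  have neg: "negligible {s\<in>{0..b}. 0 < g s}" if b: "ereal b < \<tau>" for b
  proof -
    obtain N where N: "negligible N" "{x. \<not> (x \<in> einterval 0 \<tau> \<longrightarrow> g x \<le> 0)} \<subseteq> N"
      using AE unfolding eventually_ae_filter_negligible by blast
    have "{s\<in>{0..b}. 0 < g s} \<subseteq> insert 0 N"
    proof
      fix s assume s: "s \<in> {s\<in>{0..b}. 0 < g s}"
      then have "ereal s < \<tau>" using b by (auto intro: le_less_trans[of _ "ereal b"])
      then show "s \<in> insert 0 N"
        using s N(2) by (cases "s = 0") (auto simp: einterval_def zero_ereal_def)
    qed
    moreover have "negligible (insert 0 N)" using N(1) by simp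
    ultimately show ?thesis by (rule negligible_subset[rotated])
  qed
  have spike: "integral {0..t} (\<lambda>s. g s * h s) = - integral {0..t} (\<lambda>s. \<bar>g s\<bar> * h s)"
    if "ereal t < \<tau>" for t h
  proof -
    have "integral {0..t} (\<lambda>s. g s * h s) = integral {0..t} (\<lambda>s. - (\<bar>g s\<bar> * h s))"
      by (rule integral_spike[OF neg[OF that]]) auto
    then show ?thesis by simp
  qed
  have G_eq: "G_fun \<alpha> g t = G t" if "ereal t < \<tau>" for t
  proof -
    have "set_lebesgue_integral lebesgue {0..t} g = - A t"
      using spike[OF that, of "\<lambda>_. 1"] set_lebesgue_integral_eq_integral(2)[OF g[of t]]
      by (simp add: A_def)
    moreover have "0 \<le> A t" unfolding A_def by (rule integral_nonneg[OF ga]) simp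
    ultimately show ?thesis
      unfolding G_fun_def G_def G_of_mass_def using \<alpha> by (simp add: abs_mult)
  qed
  have Apos: "0 < A t" if "0 < t" "ereal t < \<tau>" for t
  proof -
    have "t \<in> einterval 0 \<tau>" using that by (auto simp: einterval_def zero_ereal_def)
    then have "0 < G t" using assms(7)[of t] G_eq[OF that(2)] by simp
    then have "A t \<noteq> 0" by (auto simp: G_def G_of_mass_def)
    moreover have "0 \<le> A t" unfolding A_def by (rule integral_nonneg[OF ga]) simp
    ultimately show ?thesis by simp
  qed
  have LJ: "L_fun \<alpha> g t = log_L (G t)" "J_fun \<alpha> g t = log_J (G t)" if "ereal t < \<tau>" for t
    using G_eq[OF that] by (simp_all add: L_fun_def J_fun_def log_L_def log_J_def)
  obtain u0 where u0: "0 < u0" "u0 \<le> exp (- 1)" and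
    ineq: "\<And>u. 0 < u \<Longrightarrow> u < u0 \<Longrightarrow> barrier \<alpha> u + deficit \<alpha> u \<le>
        k0 \<alpha> * u - K0 \<alpha> * u * (log_L u)\<^sup>2 * (1 + (log_J u)\<^sup>2)"
    using barrier_inequality[OF \<alpha>] by blast
  obtain \<tau>' where \<tau>': "0 < \<tau>'" "ereal \<tau>' < \<tau>"
    using ereal_dense2[OF assms(5)] by (auto simp: zero_ereal_def)
  have Gc: "continuous_on {0..\<tau>'} G"
  proof -
    have "continuous_on {0..\<tau>'} A"
      unfolding A_def by (rule indefinite_integral_continuous_1[OF ga])
    moreover have "0 \<le> A t" for t unfolding A_def by (rule integral_nonneg[OF ga]) simp
    ultimately show ?thesis
      unfolding G_def[abs_def] G_of_mass_def using \<alpha>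
      by (intro continuous_on_powr' continuous_intros) auto
  qed
  have G0: "G 0 = 0" by (simp add: G_def A_def G_of_mass_def)
  obtain d where d: "0 < d" "\<And>t. t \<in> {0..\<tau>'} \<Longrightarrow> dist t 0 < d \<Longrightarrow> dist (G t) (G 0) < u0"
    using Gc \<tau>'(1) u0(1) unfolding continuous_on_iff by (meson atLeastAtMost_iff less_imp_le order_refl)
  \<comment> \<open>On \<open>{0<..\<delta>}\<close> one has \<open>G < u0 \<le> 1 / e\<close>, so every logarithm involved is defined.\<close>
  define \<delta> where "\<delta> = min (d / 2) \<tau>'"
  have \<delta>: "0 < \<delta>" "\<delta> \<le> \<tau>'" "\<delta> < d" using d(1) \<tau>'(1) by (auto simp: \<delta>_def min_def)
  have lt: "ereal t < \<tau>" if "t \<le> \<delta>" for t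
    using that \<delta>(2) \<tau>'(2) by (auto intro: le_less_trans[of _ "ereal \<tau>'"])
  have Gr: "0 < G t" "G t < u0" if t: "0 < t" "t \<le> \<delta>" for t
  proof -
    show "0 < G t" using Apos[OF t(1) lt[OF t(2)]] \<alpha> by (simp add: G_def G_of_mass_def)
    have "dist (G t) (G 0) < u0" using t \<delta> by (intro d(2)) auto
    then show "G t < u0" by (simp add: G0 dist_real_def)
  qed
  define v where "v t = barrier \<alpha> (G t)" for t
  have hi: "((\<lambda>s. \<bar>g s\<bar> * v s powr (- \<alpha>)) has_integral deficit \<alpha> (G t)) {0..t}" if t: "0 < t" "t \<le> \<delta>" for t
    unfolding v_def
  proof (rule barrier_has_integral[OF \<alpha> t(1) g])
    show "G s = G_of_mass \<alpha> (integral {0..s} (\<lambda>r. \<bar>g r\<bar>))" for s by (simp add: G_def A_def)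
    show "0 < integral {0..s} (\<lambda>r. \<bar>g r\<bar>)" if "0 < s" "s \<le> t" for s
      using Apos[OF that(1) lt] that t unfolding A_def by auto
    show "G t < exp (- 1)" using Gr[OF t] u0 by simp
  qed
  have gi: "integral {0..t} (\<lambda>s. g s * v s powr (- \<alpha>)) = - deficit \<alpha> (G t)" if t: "0 < t" "t \<le> \<delta>" for t
    using spike[OF lt[OF t(2)]] integral_unique[OF hi[OF t]] by simp
  have vi: "(\<lambda>s. g s * v s powr (- \<alpha>)) absolutely_integrable_on {0..\<delta>}"
  proof -
    have "(\<lambda>s. \<bar>g s\<bar> * v s powr (- \<alpha>)) absolutely_integrable_on {0..\<delta>}"
      using hi[OF \<delta>(1) order_refl] by (intro nonnegative_absolutely_integrable_1) auto
    then have "(\<lambda>s. \<bar>g s\<bar> * v s powr (- \<alpha>) * - 1) absolutely_integrable_on {0..\<delta>}"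
      by (rule absolutely_integrable_mult_continuous) (rule continuous_on_const)
    then show ?thesis
      by (rule absolutely_integrable_spike[OF _ neg[OF lt[OF order_refl]]]) auto
  qed
  have vpos: "0 < v t" if "0 < t" "t \<le> \<delta>" for t
    unfolding v_def barrier_def using Gr[OF that] deficit'_pos[OF \<alpha>, of "G t"] by simp
  have sub: "v t \<le> f t + integral {0..t} (\<lambda>s. g s * v s powr (- \<alpha>))" if t: "0 < t" "t \<le> \<delta>" for t
  proof -
    have e: "t \<in> einterval 0 \<tau>" using t lt[OF t(2)] by (auto simp: einterval_def zero_ereal_def)
    have "LJ_defined \<alpha> g t"
    proof -
      have "G t < exp (- 1)" using Gr(2)[OF t] u0(2) by (rule less_le_trans)
      note l = log_LJ_eq(1,2)[OF Gr(1)[OF t] this]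
      have "0 < log_L (G t)" unfolding l(2) using l(1) by (intro divide_pos_pos) auto
      moreover have "log_L (G t) < 1" unfolding l(2) using l(1) by (subst divide_less_eq_1_pos) auto
      ultimately have "ln (log_L (G t)) \<noteq> 0" by simp
      moreover have "ln (G t) \<noteq> 0" using l(1) by auto
      ultimately show ?thesis
        unfolding LJ_defined_def G_eq[OF lt[OF t(2)]] LJ[OF lt[OF t(2)]]
        using Gr[OF t] by simp
    qed
    from assms(8)[OF e this] ineq[OF Gr[OF t]]
    have "v t + deficit \<alpha> (G t) \<le> f t"
      unfolding G_eq[OF lt[OF t(2)]] LJ[OF lt[OF t(2)]] v_def by linarith
    then show ?thesis using gi[OF t] by simp
  qed
  note main = x_tilde_above_barrier[OF \<alpha> g f f0 \<delta>(1) neg[OF lt[OF order_refl]] vpos vi sub]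
  show ?thesis
  proof (intro exI[of _ \<delta>] conjI allI impI ballI)
    show "ereal \<delta> \<le> \<tau>" using lt[OF order_refl] by simp
    show "is_solution \<alpha> f g (ereal \<delta>) (x_tilde \<alpha> f g)" by (rule main(1))
    show "x t \<le> x_tilde \<alpha> f g t" if "is_solution \<alpha> f g \<delta>' x" "0 \<le> t \<and> ereal t < \<delta>'" for \<delta>' x t
      using is_solution_le_x_tilde[OF \<alpha> g f that(1)] that(2) by auto
    fix t assume t: "t \<in> {0<..<\<delta>}"
    show "0 \<ge> x_tilde \<alpha> f g t - f t" using main(2)[of t] t by auto
    have "- deficit \<alpha> (G t) \<le> x_tilde \<alpha> f g t - f t" using main(3)[of t] gi[of t] t by auto
    then show "x_tilde \<alpha> f g t - f t \<ge>
        - (\<alpha> powr (- (\<alpha> / (\<alpha> + 1)))) *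
          (G_fun \<alpha> g t + \<alpha> / (\<alpha> + 1) * G_fun \<alpha> g t * L_fun \<alpha> g t *
             (1 + J_fun \<alpha> g t + (J_fun \<alpha> g t)\<^sup>2))"
      using t lt[of t] by (simp add: G_eq LJ deficit_def log_P_def mult.assoc)
  qed (rule \<delta>(1))
qed

end
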